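(* Let $\mathbf I$ be a well-ordered set, let $\mathsf E$ be the category of left $R$-modules or the category of right $R$-modules over a ring $R$, and let $f:\mathbf I\to\mathsf E$ be a functor (with $\mathbf I$ regarded as a poset category). Then there exists a unique complete lattice homomorphism $\Omega:\mathbb A(\mathbb I(\mathbf I))\to \mathrm{Sub}(f)$ such that $$\frac{\Omega(\downarrow J)}{\Omega(\mathring\downarrow J)}\in \mathrm{Int}(J)$$ for each $J\in\mathbb I(\mathbf I)$.
   Context: For a poset $P$, $\mathbb A(P)$ is the lattice of down-closed subsets of $P$, ordered by inclusion. $\mathbb I(\mathbf I)$ is the set of nonempty intervals (order-convex subsets) of $\mathbf I$. For $J\in\mathbb I(\mathbf I)$ and $S,T\in\mathbb A(\mathbf I)$ write $J\sim(S,T)$ if $J=T\setminus S$. Partially order $\mathbb I(\mathbf I)$ by: $J\le J'$ iff there are $S,T,S',T'\in\mathbb A(\mathbf I)$ with $J\sim(S,T)$, $J'\sim(S',T')$, $S\subseteq S'$ and $T\subseteq T'$. Put $\downarrow J=\{L\in\mathbb I(\mathbf I):L\le J\}$ and $\mathring\downarrow J=\{L\in\mathbb I(\mathbf I):L<J\}$. $\mathrm{Sub}(f)$ is the lattice of subobjects (subfunctors) of $f$ in the functor category $[\mathbf I,\mathsf E]$, ordered by inclusion; it is a complete lattice. A fraction of nested subobjects denotes the quotient object in $[\mathbf I,\mathsf E]$. A lattice homomorphism is complete if its domain and codomain are complete lattices and it preserves arbitrary (including empty) meets and joins. A functor $g:\mathbf I\to\mathsf E$ is an interval diagram of support type $J$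 if $g_a=0$ for all $a\notin J$ and $g(a\le b)$ is an isomorphism for all $a\le b$ in $J$ (so the zero functor has every support type). $\mathrm{Int}(J)$ is the class of interval diagrams of support type $J$. *)

theory Defs
  imports "HOL-Algebra.Complete_Lattice" "HOL-Algebra.AbelCoset" "HOL-Algebra.Module"
begin

section \<open>Posets of down-sets and of intervals\<close>

definition well_ordered_set :: "('i, 'c) gorder_scheme \<Rightarrow> bool" where
  "well_ordered_set I \<longleftrightarrow>
     partial_order I \<and>
     well_order_on (carrier I) {(a, b). a \<in> carrier I \<and> b \<in> carrier I \<and> a \<sqsubseteq>\<^bsub>I\<^esub> b}"

definition downset_lattice :: "('a, 'c) gorder_scheme \<Rightarrow> 'a set gorder" where
  "downset_lattice P =
     \<lparr> carrier = {S. S \<subseteq> carrier P \<and> (\<forall>x\<in>S. \<forall>y\<in>carrier P. y \<sqsubseteq>\<^bsub>P\<^esub> x \<longrightarrow> y \<in> S)},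
       eq = (=), le = (\<subseteq>) \<rparr>"

definition intervals :: "('i, 'c) gorder_scheme \<Rightarrow> 'i set set" where
  "intervals I =
     {J. J \<noteq> {} \<and> J \<subseteq> carrier I \<and>
         (\<forall>a\<in>J. \<forall>c\<in>J. \<forall>b\<in>carrier I. a \<sqsubseteq>\<^bsub>I\<^esub> b \<and> b \<sqsubseteq>\<^bsub>I\<^esub> c \<longrightarrow> b \<in> J)}"

definition represents :: "'i set \<Rightarrow> 'i set \<Rightarrow> 'i set \<Rightarrow> bool" where
  "represents J S T \<longleftrightarrow> J = T - S"

definition interval_le :: "('i, 'c) gorder_scheme \<Rightarrow> 'i set \<Rightarrow> 'i set \<Rightarrow> bool" where
  "interval_le I J J' \<longleftrightarrow>
     (\<exists>S \<in> carrier (downset_lattice I). \<exists>T \<in> carrier (downset_lattice I).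
      \<exists>S' \<in> carrier (downset_lattice I). \<exists>T' \<in> carrier (downset_lattice I).
        represents J S T \<and> represents J' S' T' \<and> S \<subseteq> S' \<and> T \<subseteq> T')"

definition interval_poset :: "('i, 'c) gorder_scheme \<Rightarrow> 'i set gorder" where
  "interval_poset I = \<lparr> carrier = intervals I, eq = (=), le = interval_le I \<rparr>"

definition down :: "('a, 'c) gorder_scheme \<Rightarrow> 'a \<Rightarrow> 'a set" where
  "down P x = {y \<in> carrier P. y \<sqsubseteq>\<^bsub>P\<^esub> x}"

definition strict_down :: "('a, 'c) gorder_scheme \<Rightarrow> 'a \<Rightarrow> 'a set" where
  "strict_down P x = {y \<in> carrier P. y \<sqsubset>\<^bsub>P\<^esub> x}"

text \<open>
  Homomorphisms are extensional (undefined off the domain lattice), so that equality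
  of two of them is equality on the domain. The conditions \<^const>\<open>sup_pres\<close> and
  \<^const>\<open>inf_pres\<close> include that both sides are complete lattices, and they range over
  all subsets of the domain, the empty one included.
\<close>

definition complete_lattice_hom ::
    "('a, 'c) gorder_scheme \<Rightarrow> ('b, 'd) gorder_scheme \<Rightarrow> ('a \<Rightarrow> 'b) set" where
  "complete_lattice_hom L M =
     {h \<in> carrier L \<rightarrow>\<^sub>E carrier M. sup_pres L M h \<and> inf_pres L M h}"


section \<open>Modules over a not necessarily commutative ring\<close>

text \<open>
  The library's \<^locale>\<open>module\<close> requires a commutative ring. Left and right modules share
  its record type: in a right module, \<open>r \<odot>\<^bsub>M\<^esub> x\<close> stands for \<open>x \<cdot> r\<close>.
  As there, the ring multiplication and unit of the record \<open>M\<close> are irrelevant.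
\<close>

locale left_module = R?: ring R + M?: abelian_group M
  for R :: "('r, 'c) ring_scheme" (structure) and M :: "('r, 'm, 'd) module_scheme" (structure) +
  assumes smult_closed: "\<lbrakk>r \<in> carrier R; x \<in> carrier M\<rbrakk> \<Longrightarrow> r \<odot>\<^bsub>M\<^esub> x \<in> carrier M"
    and smult_l_distr: "\<lbrakk>r \<in> carrier R; s \<in> carrier R; x \<in> carrier M\<rbrakk> \<Longrightarrow>
      (r \<oplus>\<^bsub>R\<^esub> s) \<odot>\<^bsub>M\<^esub> x = r \<odot>\<^bsub>M\<^esub> x \<oplus>\<^bsub>M\<^esub> s \<odot>\<^bsub>M\<^esub> x"
    and smult_r_distr: "\<lbrakk>r \<in> carrier R; x \<in> carrier M; y \<in> carrier M\<rbrakk> \<Longrightarrow>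
      r \<odot>\<^bsub>M\<^esub> (x \<oplus>\<^bsub>M\<^esub> y) = r \<odot>\<^bsub>M\<^esub> x \<oplus>\<^bsub>M\<^esub> r \<odot>\<^bsub>M\<^esub> y"
    and smult_assoc: "\<lbrakk>r \<in> carrier R; s \<in> carrier R; x \<in> carrier M\<rbrakk> \<Longrightarrow>
      (r \<otimes>\<^bsub>R\<^esub> s) \<odot>\<^bsub>M\<^esub> x = r \<odot>\<^bsub>M\<^esub> (s \<odot>\<^bsub>M\<^esub> x)"
    and smult_one: "x \<in> carrier M \<Longrightarrow> \<one>\<^bsub>R\<^esub> \<odot>\<^bsub>M\<^esub> x = x"

locale right_module = R?: ring R + M?: abelian_group M
  for R :: "('r, 'c) ring_scheme" (structure) and M :: "('r, 'm, 'd) module_scheme" (structure) +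
  assumes smult_closed: "\<lbrakk>r \<in> carrier R; x \<in> carrier M\<rbrakk> \<Longrightarrow> r \<odot>\<^bsub>M\<^esub> x \<in> carrier M"
    and smult_l_distr: "\<lbrakk>r \<in> carrier R; s \<in> carrier R; x \<in> carrier M\<rbrakk> \<Longrightarrow>
      (r \<oplus>\<^bsub>R\<^esub> s) \<odot>\<^bsub>M\<^esub> x = r \<odot>\<^bsub>M\<^esub> x \<oplus>\<^bsub>M\<^esub> s \<odot>\<^bsub>M\<^esub> x"
    and smult_r_distr: "\<lbrakk>r \<in> carrier R; x \<in> carrier M; y \<in> carrier M\<rbrakk> \<Longrightarrow>
      r \<odot>\<^bsub>M\<^esub> (x \<oplus>\<^bsub>M\<^esub> y) = r \<odot>\<^bsub>M\<^esub> x \<oplus>\<^bsub>M\<^esub> r \<odot>\<^bsub>M\<^esub> y"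
    and smult_assoc: "\<lbrakk>r \<in> carrier R; s \<in> carrier R; x \<in> carrier M\<rbrakk> \<Longrightarrow>
      (r \<otimes>\<^bsub>R\<^esub> s) \<odot>\<^bsub>M\<^esub> x = s \<odot>\<^bsub>M\<^esub> (r \<odot>\<^bsub>M\<^esub> x)"
    and smult_one: "x \<in> carrier M \<Longrightarrow> \<one>\<^bsub>R\<^esub> \<odot>\<^bsub>M\<^esub> x = x"

datatype side = Left | Right

definition is_module :: "side \<Rightarrow> ('r, 'c) ring_scheme \<Rightarrow> ('r, 'm, 'd) module_scheme \<Rightarrow> bool" where
  "is_module s R M = (case s of Left \<Rightarrow> left_module R M | Right \<Rightarrow> right_module R M)"

definition linear_maps ::
    "('r, 'c) ring_scheme \<Rightarrow> ('r, 'm, 'd) module_scheme \<Rightarrow> ('r, 'n, 'e) module_scheme \<Rightarrow> ('m \<Rightarrow> 'n) set"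
  where
  "linear_maps R M N =
     {\<phi> \<in> carrier M \<rightarrow> carrier N.
        (\<forall>x\<in>carrier M. \<forall>y\<in>carrier M. \<phi> (x \<oplus>\<^bsub>M\<^esub> y) = \<phi> x \<oplus>\<^bsub>N\<^esub> \<phi> y) \<and>
        (\<forall>r\<in>carrier R. \<forall>x\<in>carrier M. \<phi> (r \<odot>\<^bsub>M\<^esub> x) = r \<odot>\<^bsub>N\<^esub> \<phi> x)}"

definition linear_isos ::
    "('r, 'c) ring_scheme \<Rightarrow> ('r, 'm, 'd) module_scheme \<Rightarrow> ('r, 'n, 'e) module_scheme \<Rightarrow> ('m \<Rightarrow> 'n) set"
  where
  "linear_isos R M N = {\<phi> \<in> linear_maps R M N. bij_betw \<phi> (carrier M) (carrier N)}"

text \<open>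
  The quotient \<open>G/H\<close> of nested submodules \<open>H \<subseteq> G\<close> of \<open>M\<close>; its elements are the cosets
  \<open>H + x\<close> with \<open>x \<in> G\<close>, and \<open>r (H + x) = H + r x\<close>.
\<close>

definition quotient_module ::
    "('r, 'm, 'd) module_scheme \<Rightarrow> 'm set \<Rightarrow> 'm set \<Rightarrow> ('r, 'm set) module" where
  "quotient_module M G H =
     \<lparr> carrier = a_rcosets\<^bsub>M\<lparr>carrier := G\<rparr>\<^esub> H,
       mult = (\<lambda>_ _. undefined), one = undefined,
       zero = H, add = (\<lambda>A B. A <+>\<^bsub>M\<^esub> B),
       smult = (\<lambda>r A. H <+>\<^bsub>M\<^esub> ((\<lambda>x. r \<odot>\<^bsub>M\<^esub> x) ` A)) \<rparr>"


section \<open>Diagrams of modules indexed by a poset\<close>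

text \<open>
  The modules of a diagram have carriers in one common type; a family of modules indexed by
  a set can always be so represented, via its disjoint union.
\<close>

record ('i, 'r, 'm) diagram =
  obj :: "'i \<Rightarrow> ('r, 'm) module"
  arr :: "'i \<Rightarrow> 'i \<Rightarrow> 'm \<Rightarrow> 'm"

definition is_functor ::
    "side \<Rightarrow> ('r, 'c) ring_scheme \<Rightarrow> ('i, 'd) gorder_scheme \<Rightarrow> ('i, 'r, 'm) diagram \<Rightarrow> bool" where
  "is_functor s R I f \<longleftrightarrow>
     (\<forall>a\<in>carrier I. is_module s R (obj f a)) \<and>
     (\<forall>a\<in>carrier I. \<forall>b\<in>carrier I. a \<sqsubseteq>\<^bsub>I\<^esub> b \<longrightarrow>
        arr f a b \<in> linear_maps R (obj f a) (obj f b)) \<and>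
     (\<forall>a\<in>carrier I. \<forall>x\<in>carrier (obj f a). arr f a a x = x) \<and>
     (\<forall>a\<in>carrier I. \<forall>b\<in>carrier I. \<forall>c\<in>carrier I. a \<sqsubseteq>\<^bsub>I\<^esub> b \<and> b \<sqsubseteq>\<^bsub>I\<^esub> c \<longrightarrow>
        (\<forall>x\<in>carrier (obj f a). arr f a c x = arr f b c (arr f a b x)))"

text \<open>
  A subfunctor is given by the carriers of its submodules, extensionally in the index.
\<close>

definition Sub ::
    "('r, 'c) ring_scheme \<Rightarrow> ('i, 'd) gorder_scheme \<Rightarrow> ('i, 'r, 'm) diagram \<Rightarrow> ('i \<Rightarrow> 'm set) gorder"
  where
  "Sub R I f =
     \<lparr> carrier = {g \<in> extensional (carrier I).
          (\<forall>a\<in>carrier I. submodule (g a) R (obj f a)) \<and>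
          (\<forall>a\<in>carrier I. \<forall>b\<in>carrier I. a \<sqsubseteq>\<^bsub>I\<^esub> b \<longrightarrow> arr f a b ` g a \<subseteq> g b)},
       eq = (=),
       le = (\<lambda>g h. \<forall>a\<in>carrier I. g a \<subseteq> h a) \<rparr>"

text \<open>
  The quotient \<open>g/h\<close> of nested subfunctors of \<open>f\<close>, with \<open>h a + x\<close> mapped to
  \<open>h b + arr f a b x\<close>.
\<close>

definition quotient_diagram ::
    "('i, 'r, 'm) diagram \<Rightarrow> ('i \<Rightarrow> 'm set) \<Rightarrow> ('i \<Rightarrow> 'm set) \<Rightarrow> ('i, 'r, 'm set) diagram" where
  "quotient_diagram f g h =
     \<lparr> obj = (\<lambda>a. quotient_module (obj f a) (g a) (h a)),
       arr = (\<lambda>a b A. h b <+>\<^bsub>obj f b\<^esub> (arr f a b ` A)) \<rparr>"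

definition interval_diagrams ::
    "side \<Rightarrow> ('r, 'c) ring_scheme \<Rightarrow> ('i, 'd) gorder_scheme \<Rightarrow> 'i set \<Rightarrow> ('i, 'r, 'm) diagram set" where
  "interval_diagrams s R I J =
     {g. is_functor s R I g \<and>
         (\<forall>a\<in>carrier I - J. carrier (obj g a) = {\<zero>\<^bsub>obj g a\<^esub>}) \<and>
         (\<forall>a\<in>J. \<forall>b\<in>J. a \<sqsubseteq>\<^bsub>I\<^esub> b \<longrightarrow> arr g a b \<in> linear_isos R (obj g a) (obj g b))}"

end

(*
  At a point a, filter f a in two ways: by the images of the f s with s \<preceq> a ("born by s") and
  by the kernels of the maps out of a, indexed by down-sets T ("dead outside T"). Both filtrations
  are indexed by well-orders, and an interval containing a is a pair (s, T). The map sending a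
  down-set D of intervals to the sum of the submodules born s a \<inter> dies T a over the pairs in D
  preserves joins by construction. For arbitrary meets, let x be born by s and lie in the sums of
  all members of a family of down-sets. Well-orderedness of the T's gives a member D0 whose bars
  starting at s belong to every other member; up to an element born strictly before s, x lies in a
  single piece born s a \<inter> dies T a of D0, hence of the intersection, and induction on s applies.

  For uniqueness, the condition on the quotients determines the values of the homomorphism on the
  down-set of intervals starting by s (surjectivity of the maps in the quotients) and on that of
  intervals ending by T (injectivity); the principal down-sets are intersections of two such.
*)

theory Submission
  imports Defs
begin

section \<open>Lattices of down-sets\<close>

text \<open>Lattices of submodules are modular but not distributive, so sums of pieces need not
  commute with intersections. What helps here is that every piece is an intersection of members of
  just two chains, images and kernels. The chains are indexed differently: an interval of a
  well-order has a least element, so births are measured by points, but it need not have a greatest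
  one, so deaths are measured by down-sets, the whole carrier standing for no death. Subtraction
  does the work of distributivity: once one summand of an element is known to lie in every member of
  a family, so does the other.

  In the uniqueness part the surjective half builds values from below, adding one interval at a
  time, whereas the injective half has to strip intervals from above, where there may be no last one
  to strip. Joins of chains of submodules are unions, so an element of a limit stage already lies in
  some earlier stage, and a well-founded linear extension of the interval order turns the stripping
  into an induction. An arbitrary down-set is then the join of its principal ones.\<close>

lemma (in partial_order) sup_eqI:
  assumes "least L s (Upper L A)"
  shows "\<Squnion>A = s"
  unfolding sup_def by (rule some_equality, rule assms, rule least_unique[OF _ assms])

lemma (in partial_order) inf_eqI:
  assumes "greatest L i (Lower L A)"
  shows "\<Sqinter>A = i"
  unfolding inf_def by (rule some_equality, rule assms, rule greatest_unique[OF _ assms])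

lemma downset_latticeI:
  assumes "\<And>x. x \<in> S \<Longrightarrow> x \<in> carrier P"
    and "\<And>x y. \<lbrakk>x \<in> S; y \<in> carrier P; y \<sqsubseteq>\<^bsub>P\<^esub> x\<rbrakk> \<Longrightarrow> y \<in> S"
  shows "S \<in> carrier (downset_lattice P)"
proof -
  have "S \<subseteq> carrier P \<and> (\<forall>x\<in>S. \<forall>y\<in>carrier P. y \<sqsubseteq>\<^bsub>P\<^esub> x \<longrightarrow> y \<in> S)"
    using assms by blast
  then show ?thesis by (simp add: downset_lattice_def)
qed

lemma downset_lattice_subset: "S \<in> carrier (downset_lattice P) \<Longrightarrow> S \<subseteq> carrier P"
  by (auto simp: downset_lattice_def)

lemma downset_latticeD:
  "\<lbrakk>S \<in> carrier (downset_lattice P); x \<in> S; y \<in> carrier P; y \<sqsubseteq>\<^bsub>P\<^esub> x\<rbrakk> \<Longrightarrow> y \<in> S"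
  by (auto simp: downset_lattice_def)

lemma downset_lattice_Union:
  "A \<subseteq> carrier (downset_lattice P) \<Longrightarrow> \<Union>A \<in> carrier (downset_lattice P)"
  by (intro downset_latticeI) (auto dest: downset_latticeD downset_lattice_subset)

text \<open>Intersecting with \<open>carrier P\<close> gives the empty family its correct meet, the
  top element.\<close>

lemma downset_lattice_Inter:
  "A \<subseteq> carrier (downset_lattice P) \<Longrightarrow> carrier P \<inter> \<Inter>A \<in> carrier (downset_lattice P)"
  by (intro downset_latticeI) (auto dest: downset_latticeD)

lemma downset_lattice_Un:
  "\<lbrakk>S \<in> carrier (downset_lattice P); T \<in> carrier (downset_lattice P)\<rbrakk> \<Longrightarrow>
    S \<union> T \<in> carrier (downset_lattice P)"
  using downset_lattice_Union[of "{S, T}" P] by simp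

lemma downset_lattice_Int:
  "\<lbrakk>S \<in> carrier (downset_lattice P); T \<in> carrier (downset_lattice P)\<rbrakk> \<Longrightarrow>
    S \<inter> T \<in> carrier (downset_lattice P)"
  using downset_lattice_Inter[of "{S, T}" P] downset_lattice_subset[of S P]
  by (simp add: Int_absorb1 Int_assoc[symmetric])

lemma downset_lattice_empty: "{} \<in> carrier (downset_lattice P)"
  by (simp add: downset_lattice_def)

lemma downset_lattice_carrier: "carrier P \<in> carrier (downset_lattice P)"
  by (simp add: downset_lattice_def)

lemma downset_lattice_le: "S \<sqsubseteq>\<^bsub>downset_lattice P\<^esub> T \<longleftrightarrow> S \<subseteq> T"
  by (simp add: downset_lattice_def)

lemma downset_lattice_partial_order: "partial_order (downset_lattice P)"
proof -
  have "(.=\<^bsub>downset_lattice P\<^esub>) = (=)"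
    by (simp add: downset_lattice_def)
  then show ?thesis
    by unfold_locales (auto simp: downset_lattice_le)
qed

lemma downset_lattice_lub:
  assumes "A \<subseteq> carrier (downset_lattice P)"
  shows "least (downset_lattice P) (\<Union>A) (Upper (downset_lattice P) A)"
  using assms downset_lattice_Union[OF assms] unfolding least_def Upper_def
  by (simp add: downset_lattice_le) blast

lemma downset_lattice_glb:
  assumes "A \<subseteq> carrier (downset_lattice P)"
  shows "greatest (downset_lattice P) (carrier P \<inter> \<Inter>A) (Lower (downset_lattice P) A)"
  using assms downset_lattice_Inter[OF assms] downset_lattice_subset[of _ P]
  unfolding greatest_def Lower_def by (simp add: downset_lattice_le) blast

lemma downset_lattice_complete: "complete_lattice (downset_lattice P)"
proof (rule partial_order.complete_latticeI[OF downset_lattice_partial_order])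
  fix A assume A: "A \<subseteq> carrier (downset_lattice P)"
  show "\<exists>s. least (downset_lattice P) s (Upper (downset_lattice P) A)"
    using downset_lattice_lub[OF A] by (rule exI)
  show "\<exists>i. greatest (downset_lattice P) i (Lower (downset_lattice P) A)"
    using downset_lattice_glb[OF A] by (rule exI)
qed

lemma downset_lattice_sup:
  "A \<subseteq> carrier (downset_lattice P) \<Longrightarrow> \<Squnion>\<^bsub>downset_lattice P\<^esub> A = \<Union>A"
  by (intro partial_order.sup_eqI downset_lattice_partial_order downset_lattice_lub)

lemma downset_lattice_inf:
  "A \<subseteq> carrier (downset_lattice P) \<Longrightarrow> \<Sqinter>\<^bsub>downset_lattice P\<^esub> A = carrier P \<inter> \<Inter>A"
  by (intro partial_order.inf_eqI downset_lattice_partial_order downset_lattice_glb)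


section \<open>Submodules and their quotients\<close>

text \<open>One closure operator serves both for the joins in \<open>Sub\<close> and for the sums
  over bars.\<close>

definition submodule_span ::
    "('r, 'c) ring_scheme \<Rightarrow> ('r, 'm, 'd) module_scheme \<Rightarrow> 'm set \<Rightarrow> 'm set" where
  "submodule_span R M Y = \<Inter>{N. submodule N R M \<and> Y \<subseteq> N}"

lemma submodule_spanI: "x \<in> Y \<Longrightarrow> x \<in> submodule_span R M Y"
  by (auto simp: submodule_span_def)

lemma submodule_span_least: "\<lbrakk>submodule N R M; Y \<subseteq> N\<rbrakk> \<Longrightarrow> submodule_span R M Y \<subseteq> N"
  by (auto simp: submodule_span_def)

lemma submodule_span_mono: "Y \<subseteq> Z \<Longrightarrow> submodule_span R M Y \<subseteq> submodule_span R M Z"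
  by (auto simp: submodule_span_def)

lemma submodule_subset: "submodule N R M \<Longrightarrow> N \<subseteq> carrier M"
  by (drule submodule.axioms(1), drule subgroup.subset) simp

lemma submodule_zero: "submodule N R M \<Longrightarrow> \<zero>\<^bsub>M\<^esub> \<in> N"
  by (drule submodule.axioms(1), drule subgroup.one_closed) simp

lemma submodule_add: "\<lbrakk>submodule N R M; x \<in> N; y \<in> N\<rbrakk> \<Longrightarrow> x \<oplus>\<^bsub>M\<^esub> y \<in> N"
  by (drule submodule.axioms(1), drule (2) subgroup.m_closed) simp

lemma submodule_neg: "\<lbrakk>submodule N R M; x \<in> N\<rbrakk> \<Longrightarrow> \<ominus>\<^bsub>M\<^esub> x \<in> N"
  unfolding a_inv_def by (drule submodule.axioms(1), drule (1) subgroup.m_inv_closed)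

lemma submodule_minus: "\<lbrakk>submodule N R M; x \<in> N; y \<in> N\<rbrakk> \<Longrightarrow> x \<ominus>\<^bsub>M\<^esub> y \<in> N"
  unfolding a_minus_def by (intro submodule_add submodule_neg)

lemmas submodule_closed =
  submodule_zero submodule_add submodule_neg submodule_minus submodule.smult_closed

lemma submoduleI:
  assumes "N \<subseteq> carrier M" and "\<zero>\<^bsub>M\<^esub> \<in> N"
    and "\<And>x. x \<in> N \<Longrightarrow> \<ominus>\<^bsub>M\<^esub> x \<in> N"
    and "\<And>x y. \<lbrakk>x \<in> N; y \<in> N\<rbrakk> \<Longrightarrow> x \<oplus>\<^bsub>M\<^esub> y \<in> N"
    and "\<And>r x. \<lbrakk>r \<in> carrier R; x \<in> N\<rbrakk> \<Longrightarrow> r \<odot>\<^bsub>M\<^esub> x \<in> N"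
  shows "submodule N R M"
  using assms by (intro submodule.intro subgroup.intro submodule_axioms.intro) (auto simp: a_inv_def)

text \<open>Two summands lie together in the larger of two members, so no further closure under
  addition is needed. This is why membership in a join of a chain can be traced to a single member,
  both in splitting sums and at the limit stages of the uniqueness proof.\<close>

lemma submodule_chain_Union:
  assumes "\<C> \<noteq> {}" and sub: "\<And>N. N \<in> \<C> \<Longrightarrow> submodule N R M"
    and chain: "\<And>N N'. \<lbrakk>N \<in> \<C>; N' \<in> \<C>\<rbrakk> \<Longrightarrow> N \<subseteq> N' \<or> N' \<subseteq> N"
  shows "submodule (\<Union>\<C>) R M"
proof (rule submoduleI)
  show "\<zero>\<^bsub>M\<^esub> \<in> \<Union>\<C>"
    using assms(1) submodule_zero[OF sub] by blast
  show "\<Union>\<C> \<subseteq> carrier M"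
    using submodule_subset[OF sub] by blast
  fix x y assume "x \<in> \<Union>\<C>" "y \<in> \<Union>\<C>"
  then obtain N where "N \<in> \<C>" "x \<in> N" "y \<in> N"
    using chain by blast
  then show "x \<oplus>\<^bsub>M\<^esub> y \<in> \<Union>\<C>"
    using submodule_add[OF sub] by blast
qed (use submodule_neg[OF sub] submodule.smult_closed[OF sub] in blast)+

text \<open>What left and right modules have in common.\<close>

locale operator_group = abelian_group M
  for R :: "('r, 'c) ring_scheme" and M :: "('r, 'm, 'd) module_scheme" (structure) +
  assumes smult_closed: "\<lbrakk>r \<in> carrier R; x \<in> carrier M\<rbrakk> \<Longrightarrow> r \<odot> x \<in> carrier M"
    and smult_r_distr: "\<lbrakk>r \<in> carrier R; x \<in> carrier M; y \<in> carrier M\<rbrakk> \<Longrightarrow>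
      r \<odot> (x \<oplus> y) = r \<odot> x \<oplus> r \<odot> y"

lemma is_module_operator_group: "is_module s R M \<Longrightarrow> operator_group R M"
  by (cases s) (auto simp: is_module_def operator_group_def operator_group_axioms_def
      left_module_def left_module_axioms_def right_module_def right_module_axioms_def)

context operator_group
begin

lemma smult_zero: "r \<in> carrier R \<Longrightarrow> r \<odot> \<zero> = \<zero>"
  using smult_r_distr[of r \<zero> \<zero>] smult_closed[of r \<zero>] by (simp add: add.l_cancel_one')

lemma carrier_submodule: "submodule (carrier M) R M"
  by (rule submoduleI) (auto intro: smult_closed)

lemma zero_submodule: "submodule {\<zero>} R M"
  by (rule submoduleI) (auto simp: smult_zero)

lemma Inter_submodule:
  assumes "\<A> \<noteq> {}" and "\<And>N. N \<in> \<A> \<Longrightarrow> submodule N R M"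
  shows "submodule (\<Inter>\<A>) R M"
  by (rule submoduleI) (use assms in \<open>auto intro: submodule_closed dest: submodule_subset\<close>)

lemma Int_submodule: "\<lbrakk>submodule N R M; submodule N' R M\<rbrakk> \<Longrightarrow> submodule (N \<inter> N') R M"
  using Inter_submodule[of "{N, N'}"] by auto

lemma span_submodule: "Y \<subseteq> carrier M \<Longrightarrow> submodule (submodule_span R M Y) R M"
  unfolding submodule_span_def by (rule Inter_submodule) (use carrier_submodule in auto)

text \<open>Gives explicit summands to the elements of a join of two submodules, which is how
  elements are decomposed later.\<close>

lemma sum_submodule:
  assumes N: "submodule N R M" and N': "submodule N' R M"
  shows "submodule {x \<oplus> y | x y. x \<in> N \<and> y \<in> N'} R M"
proof (rule submoduleI)
  note sub = submodule_subset[OF N, THEN subsetD] submodule_subset[OF N', THEN subsetD]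
  show "{x \<oplus> y | x y. x \<in> N \<and> y \<in> N'} \<subseteq> carrier M"
    using sub by auto
  show "\<zero> \<in> {x \<oplus> y | x y. x \<in> N \<and> y \<in> N'}"
    using submodule_zero[OF N] submodule_zero[OF N'] by force
  fix z assume "z \<in> {x \<oplus> y | x y. x \<in> N \<and> y \<in> N'}"
  then obtain x y where z: "z = x \<oplus> y" "x \<in> N" "y \<in> N'" by auto
  have "\<ominus> z = \<ominus> x \<oplus> \<ominus> y" using z sub by (simp add: minus_add)
  then show "\<ominus> z \<in> {x \<oplus> y | x y. x \<in> N \<and> y \<in> N'}"
    using z N N' by (blast intro: submodule_neg)
  show "r \<odot> z \<in> {x \<oplus> y | x y. x \<in> N \<and> y \<in> N'}" if r: "r \<in> carrier R" for r
  proof -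
    have "r \<odot> z = r \<odot> x \<oplus> r \<odot> y" using z sub r by (simp add: smult_r_distr)
    then show ?thesis using z N N' r by (blast intro: submodule.smult_closed)
  qed
  fix w assume "w \<in> {x \<oplus> y | x y. x \<in> N \<and> y \<in> N'}"
  then obtain u v where w: "w = u \<oplus> v" "u \<in> N" "v \<in> N'" by auto
  have "z \<oplus> w = (x \<oplus> u) \<oplus> (y \<oplus> v)" using z w sub by (simp add: a_ac)
  then show "z \<oplus> w \<in> {x \<oplus> y | x y. x \<in> N \<and> y \<in> N'}"
    using z w N N' by (blast intro: submodule_add)
qed

end

section \<open>Linear maps: images and preimages of submodules\<close>

locale linear_map = M: operator_group R M + N: operator_group R N
  for R :: "('r, 'c) ring_scheme" and M :: "('r, 'm, 'd) module_scheme"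
    and N :: "('r, 'n, 'e) module_scheme" +
  fixes \<phi>
  assumes linear: "\<phi> \<in> linear_maps R M N"
begin

lemma map_closed: "x \<in> carrier M \<Longrightarrow> \<phi> x \<in> carrier N"
  using linear by (auto simp: linear_maps_def)

lemma map_add: "\<lbrakk>x \<in> carrier M; y \<in> carrier M\<rbrakk> \<Longrightarrow> \<phi> (x \<oplus>\<^bsub>M\<^esub> y) = \<phi> x \<oplus>\<^bsub>N\<^esub> \<phi> y"
  using linear by (auto simp: linear_maps_def)

lemma map_smult: "\<lbrakk>r \<in> carrier R; x \<in> carrier M\<rbrakk> \<Longrightarrow> \<phi> (r \<odot>\<^bsub>M\<^esub> x) = r \<odot>\<^bsub>N\<^esub> \<phi> x"
  using linear by (auto simp: linear_maps_def)

lemma map_zero: "\<phi> \<zero>\<^bsub>M\<^esub> = \<zero>\<^bsub>N\<^esub>"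
  using map_add[of "\<zero>\<^bsub>M\<^esub>" "\<zero>\<^bsub>M\<^esub>"] map_closed[of "\<zero>\<^bsub>M\<^esub>"]
  by (simp add: N.add.l_cancel_one')

lemma map_neg: "x \<in> carrier M \<Longrightarrow> \<phi> (\<ominus>\<^bsub>M\<^esub> x) = \<ominus>\<^bsub>N\<^esub> \<phi> x"
  by (metis M.a_inv_closed M.l_neg N.minus_equality map_add map_closed map_zero)

lemma map_minus: "\<lbrakk>x \<in> carrier M; y \<in> carrier M\<rbrakk> \<Longrightarrow> \<phi> (x \<ominus>\<^bsub>M\<^esub> y) = \<phi> x \<ominus>\<^bsub>N\<^esub> \<phi> y"
  by (simp add: a_minus_def map_add map_neg)

lemma image_submodule:
  assumes U: "submodule U R M"
  shows "submodule (\<phi> ` U) R N"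
proof (rule submoduleI)
  note sub = submodule_subset[OF U, THEN subsetD]
  show "\<phi> ` U \<subseteq> carrier N" using sub map_closed by auto
  show "\<zero>\<^bsub>N\<^esub> \<in> \<phi> ` U" using map_zero submodule_zero[OF U] by force
  show "\<ominus>\<^bsub>N\<^esub> x \<in> \<phi> ` U" if "x \<in> \<phi> ` U" for x
    using that sub submodule_neg[OF U] by (auto simp flip: map_neg)
  show "x \<oplus>\<^bsub>N\<^esub> y \<in> \<phi> ` U" if "x \<in> \<phi> ` U" "y \<in> \<phi> ` U" for x y
    using that sub submodule_add[OF U] by (auto simp flip: map_add)
  show "r \<odot>\<^bsub>N\<^esub> x \<in> \<phi> ` U" if "r \<in> carrier R" "x \<in> \<phi> ` U" for r x
    using that sub submodule.smult_closed[OF U] by (auto simp flip: map_smult)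
qed

lemma preimage_submodule:
  assumes V: "submodule V R N"
  shows "submodule {x \<in> carrier M. \<phi> x \<in> V} R M"
  by (rule submoduleI)
    (auto simp: map_zero map_neg map_add map_smult M.smult_closed submodule_closed[OF V])

end

section \<open>Cosets and quotient modules\<close>

lemma a_r_coset_iff: "y \<in> H +>\<^bsub>M\<^esub> x \<longleftrightarrow> (\<exists>h\<in>H. y = h \<oplus>\<^bsub>M\<^esub> x)"
  by (auto simp: a_r_coset_def')

lemma set_add_iff: "y \<in> A <+>\<^bsub>M\<^esub> B \<longleftrightarrow> (\<exists>a\<in>A. \<exists>b\<in>B. y = a \<oplus>\<^bsub>M\<^esub> b)"
  by (auto simp: set_add_def set_mult_def)

lemma quotient_module_carrier: "carrier (quotient_module M G H) = (\<lambda>x. H +>\<^bsub>M\<^esub> x) ` G"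
  by (auto simp: quotient_module_def A_RCOSETS_def' a_r_coset_def')

context operator_group
begin

lemma coset_eq_iff:
  assumes H: "submodule H R M" and "x \<in> carrier M" "y \<in> carrier M"
  shows "H +> x = H +> y \<longleftrightarrow> x \<ominus> y \<in> H"
proof
  note sub = submodule_subset[OF H, THEN subsetD]
  assume "H +> x = H +> y"
  moreover have "x \<in> H +> x"
    using submodule_zero[OF H] assms by (force simp: a_r_coset_iff)
  ultimately obtain h where "h \<in> H" "x = h \<oplus> y" by (auto simp: a_r_coset_iff)
  then show "x \<ominus> y \<in> H"
    using assms sub by (simp add: a_minus_def a_assoc r_neg)
next
  note sub = submodule_subset[OF H, THEN subsetD]
  assume xy: "x \<ominus> y \<in> H"
  have "H +> u \<subseteq> H +> v" if "u \<ominus> v \<in> H" "u \<in> carrier M" "v \<in> carrier M" for u v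
  proof
    fix z assume "z \<in> H +> u"
    then obtain h where h: "h \<in> H" "z = h \<oplus> u" by (auto simp: a_r_coset_iff)
    then have "z = (h \<oplus> (u \<ominus> v)) \<oplus> v"
      using that sub by (simp add: a_minus_def a_assoc l_neg)
    then show "z \<in> H +> v"
      using h that submodule_add[OF H] by (auto simp: a_r_coset_iff)
  qed
  moreover have "y \<ominus> x \<in> H"
    using submodule_neg[OF H xy] assms by (simp add: a_minus_def minus_add a_comm)
  ultimately show "H +> x = H +> y"
    using xy assms by blast
qed

lemma coset_zero: "submodule H R M \<Longrightarrow> H +> \<zero> = H"
  using submodule_subset[of H R M] by (force simp: a_r_coset_iff)

lemma coset_eq_self_iff:
  assumes "submodule H R M" and "x \<in> carrier M"
  shows "H +> x = H \<longleftrightarrow> x \<in> H"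
proof -
  have "x \<ominus> \<zero> = x"
    using assms(2) by (metis a_minus_def l_zero minus_equality r_zero zero_closed)
  then show ?thesis
    using coset_eq_iff[OF assms zero_closed] coset_zero[OF assms(1)] by simp
qed

lemma coset_add:
  assumes H: "submodule H R M" and "x \<in> carrier M" "y \<in> carrier M"
  shows "(H +> x) <+>\<^bsub>M\<^esub> (H +> y) = H +> (x \<oplus> y)"
proof -
  note sub = submodule_subset[OF H, THEN subsetD]
  have *: "(h \<oplus> x) \<oplus> (k \<oplus> y) = (h \<oplus> k) \<oplus> (x \<oplus> y)" if "h \<in> H" "k \<in> H" for h k
    using assms that sub by (simp add: a_ac)
  show ?thesis
  proof (intro equalityI subsetI)
    fix z assume "z \<in> (H +> x) <+>\<^bsub>M\<^esub> (H +> y)"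
    then obtain h k where "h \<in> H" "k \<in> H" "z = (h \<oplus> x) \<oplus> (k \<oplus> y)"
      by (auto simp: a_r_coset_iff set_add_iff)
    then show "z \<in> H +> (x \<oplus> y)"
      using * submodule_add[OF H] by (auto simp: a_r_coset_iff)
  next
    fix z assume "z \<in> H +> (x \<oplus> y)"
    then obtain h where "h \<in> H" "z = h \<oplus> (x \<oplus> y)" by (auto simp: a_r_coset_iff)
    \<comment> \<open>All of \<open>h\<close> is put into the first coset; the second contributes
      its representative \<open>y\<close>.\<close>
    then have "z = (h \<oplus> x) \<oplus> (\<zero> \<oplus> y)"
      using *[of h \<zero>] sub submodule_zero[OF H] by auto
    moreover have "h \<oplus> x \<in> H +> x" "\<zero> \<oplus> y \<in> H +> y"
      using \<open>h \<in> H\<close> submodule_zero[OF H] unfolding a_r_coset_iff by blast+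
    ultimately show "z \<in> (H +> x) <+>\<^bsub>M\<^esub> (H +> y)"
      unfolding set_add_iff by blast
  qed
qed

end

text \<open>The action of a scalar and the maps of a quotient diagram are both of this form.\<close>

lemma coset_image:
  assumes "abelian_group M" and "operator_group R N" and H: "submodule H R M" and K: "submodule K R N"
    and add: "\<And>x y. \<lbrakk>x \<in> carrier M; y \<in> carrier M\<rbrakk> \<Longrightarrow> \<phi> (x \<oplus>\<^bsub>M\<^esub> y) = \<phi> x \<oplus>\<^bsub>N\<^esub> \<phi> y"
    and closed: "\<And>x. x \<in> carrier M \<Longrightarrow> \<phi> x \<in> carrier N"
    and sub: "\<phi> ` H \<subseteq> K" and x: "x \<in> carrier M"
  shows "K <+>\<^bsub>N\<^esub> \<phi> ` (H +>\<^bsub>M\<^esub> x) = K +>\<^bsub>N\<^esub> \<phi> x"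
proof -
  interpret M: abelian_group M by fact
  interpret N: operator_group R N by fact
  note H' = submodule_subset[OF H, THEN subsetD] and K' = submodule_subset[OF K, THEN subsetD]
  show ?thesis
  proof (intro equalityI subsetI)
    fix z assume "z \<in> K <+>\<^bsub>N\<^esub> \<phi> ` (H +>\<^bsub>M\<^esub> x)"
    then obtain k h where kh: "k \<in> K" "h \<in> H" "z = k \<oplus>\<^bsub>N\<^esub> \<phi> (h \<oplus>\<^bsub>M\<^esub> x)"
      by (auto simp: a_r_coset_iff set_add_iff)
    then have "z = (k \<oplus>\<^bsub>N\<^esub> \<phi> h) \<oplus>\<^bsub>N\<^esub> \<phi> x"
      using H' K' x closed by (simp add: add N.a_assoc)
    moreover have "k \<oplus>\<^bsub>N\<^esub> \<phi> h \<in> K"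
      using kh sub by (intro submodule_add[OF K]) auto
    ultimately show "z \<in> K +>\<^bsub>N\<^esub> \<phi> x" by (auto simp: a_r_coset_iff)
  next
    fix z assume "z \<in> K +>\<^bsub>N\<^esub> \<phi> x"
    then obtain k where k: "k \<in> K" "z = k \<oplus>\<^bsub>N\<^esub> \<phi> x"
      by (auto simp: a_r_coset_iff)
    moreover have "x \<in> H +>\<^bsub>M\<^esub> x"
      using submodule_zero[OF H] x by (force simp: a_r_coset_iff)
    ultimately show "z \<in> K <+>\<^bsub>N\<^esub> \<phi> ` (H +>\<^bsub>M\<^esub> x)"
      by (auto simp: set_add_iff)
  qed
qed

text \<open>Multiplication by \<open>r\<close> may shrink \<open>H\<close>; adding \<open>H\<close>
  back, as the scalar action of the quotient does, restores a full coset.\<close>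

lemma (in operator_group) quotient_smult:
  assumes H: "submodule H R M" and "x \<in> carrier M" "r \<in> carrier R"
  shows "r \<odot>\<^bsub>quotient_module M G H\<^esub> (H +> x) = H +> (r \<odot> x)"
proof -
  have "H <+>\<^bsub>M\<^esub> (\<lambda>x. r \<odot> x) ` (H +> x) = H +> (r \<odot> x)"
    using assms by (intro coset_image[OF abelian_group_axioms operator_group_axioms H H])
      (auto simp: smult_r_distr smult_closed submodule.smult_closed)
  then show ?thesis by (simp add: quotient_module_def)
qed

lemma (in operator_group) quotient_add:
  assumes "submodule H R M" and "x \<in> carrier M" "y \<in> carrier M"
  shows "(H +> x) \<oplus>\<^bsub>quotient_module M G H\<^esub> (H +> y) = H +> (x \<oplus> y)"
  using coset_add[OF assms] by (simp add: quotient_module_def)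

lemma (in operator_group) quotient_abelian_group:
  assumes G: "submodule G R M" and H: "submodule H R M" and "H \<subseteq> G"
  shows "abelian_group (quotient_module M G H)"
proof -
  let ?Q = "quotient_module M G H"
  note sub = submodule_subset[OF G, THEN subsetD]
  have zero: "\<zero>\<^bsub>?Q\<^esub> = H +> \<zero>" using coset_zero[OF H] by (simp add: quotient_module_def)
  note q = quotient_module_carrier zero quotient_add[OF H]
  have elem: "\<exists>g\<in>G. g \<in> carrier M \<and> x = H +> g" if "x \<in> carrier ?Q" for x
    using that sub by (auto simp: quotient_module_carrier)
  show ?thesis
  proof (rule abelian_groupI)
    show "\<exists>y\<in>carrier ?Q. y \<oplus>\<^bsub>?Q\<^esub> x = \<zero>\<^bsub>?Q\<^esub>" if x: "x \<in> carrier ?Q" for x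
    proof -
      obtain g where g: "g \<in> G" "x = H +> g" using x by (auto simp: q)
      then have "(H +> \<ominus> g) \<oplus>\<^bsub>?Q\<^esub> x = \<zero>\<^bsub>?Q\<^esub>" using sub by (simp add: q l_neg)
      then show ?thesis using g submodule_neg[OF G] by (auto simp: q)
    qed
    show "\<zero>\<^bsub>?Q\<^esub> \<in> carrier ?Q"
      unfolding zero quotient_module_carrier using submodule_zero[OF G] by blast
    fix x y assume x: "x \<in> carrier ?Q" and y: "y \<in> carrier ?Q"
    obtain g where g: "g \<in> G" "g \<in> carrier M" "x = H +> g"
      using elem[OF x] by blast
    obtain h where h: "h \<in> G" "h \<in> carrier M" "y = H +> h"
      using elem[OF y] by blast
    show "x \<oplus>\<^bsub>?Q\<^esub> y \<in> carrier ?Q"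
      using g h submodule_add[OF G] by (simp add: q)
    show "x \<oplus>\<^bsub>?Q\<^esub> y = y \<oplus>\<^bsub>?Q\<^esub> x"
      using g h by (simp add: q a_comm)
    show "\<zero>\<^bsub>?Q\<^esub> \<oplus>\<^bsub>?Q\<^esub> x = x"
      using g by (simp add: q)
    fix z assume z: "z \<in> carrier ?Q"
    obtain k where "k \<in> G" "k \<in> carrier M" "z = H +> k"
      using elem[OF z] by blast
    then show "x \<oplus>\<^bsub>?Q\<^esub> y \<oplus>\<^bsub>?Q\<^esub> z = x \<oplus>\<^bsub>?Q\<^esub> (y \<oplus>\<^bsub>?Q\<^esub> z)"
      using g h by (simp add: q a_assoc)
  qed
qed

lemma quotient_is_module:
  assumes M: "is_module s R M" and G: "submodule G R M" and H: "submodule H R M" and HG: "H \<subseteq> G"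
  shows "is_module s R (quotient_module M G H)"
proof -
  interpret operator_group R M using is_module_operator_group[OF M] .
  note sub = submodule_subset[OF G, THEN subsetD] and
    q = quotient_module_carrier quotient_add[OF H] quotient_smult[OF H]
  note ab = quotient_abelian_group[OF G H HG]
  show ?thesis
  \<comment> \<open>The two sides differ only in the order of the scalars in
    \<open>smult_assoc\<close>; the passage to cosets is the same computation.\<close>
  proof (cases s)
    case Left
    interpret left_module R M using M Left by (simp add: is_module_def)
    have "left_module R (quotient_module M G H)"
      by (intro left_module.intro left_module_axioms.intro ab R.ring_axioms)
        (use sub submodule_closed[OF G] in \<open>auto simp: q smult_l_distr smult_r_distr smult_assoc
          smult_one smult_closed\<close>)
    then show ?thesis using Left by (simp add: is_module_def)
  next
    case Right
    interpret right_module R M using M Right by (simp add: is_module_def)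
    have "right_module R (quotient_module M G H)"
      by (intro right_module.intro right_module_axioms.intro ab R.ring_axioms)
        (use sub submodule_closed[OF G] in \<open>auto simp: q smult_l_distr smult_r_distr smult_assoc
          smult_one smult_closed\<close>)
    then show ?thesis using Right by (simp add: is_module_def)
  qed
qed


section \<open>Intervals of a well-ordered set\<close>

locale well_ordered =
  fixes I :: "('i, 'c) gorder_scheme"
  assumes well_ordered: "well_ordered_set I"
begin

abbreviation leq (infix \<open>\<preceq>\<close> 50) where "a \<preceq> b \<equiv> a \<sqsubseteq>\<^bsub>I\<^esub> b"

abbreviation "points \<equiv> carrier I"

abbreviation "downsets \<equiv> carrier (downset_lattice I)"

abbreviation "interval_downsets \<equiv> carrier (downset_lattice (interval_poset I))"

lemma refl: "a \<in> points \<Longrightarrow> a \<preceq> a"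
  using well_ordered weak_partial_order.le_refl[of I]
  by (auto simp: well_ordered_set_def partial_order_def)

lemma trans: "\<lbrakk>a \<preceq> b; b \<preceq> c; a \<in> points; b \<in> points; c \<in> points\<rbrakk> \<Longrightarrow> a \<preceq> c"
  using well_ordered weak_partial_order.le_trans[of I a b c]
  by (auto simp: well_ordered_set_def partial_order_def)

lemma antisym: "\<lbrakk>a \<preceq> b; b \<preceq> a; a \<in> points; b \<in> points\<rbrakk> \<Longrightarrow> a = b"
  using well_ordered partial_order.le_antisym[of I a b]
  by (auto simp: well_ordered_set_def)

lemma total: "\<lbrakk>a \<in> points; b \<in> points\<rbrakk> \<Longrightarrow> a \<preceq> b \<or> b \<preceq> a"
  using well_ordered refl
  by (cases "a = b") (auto simp: well_ordered_set_def well_order_on_def linear_order_on_def total_on_def)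

lemma wf_less: "wf {(a, b). a \<in> points \<and> b \<in> points \<and> a \<preceq> b \<and> a \<noteq> b}"
proof -
  have "{(a, b). a \<in> points \<and> b \<in> points \<and> a \<preceq> b} - Id =
      {(a, b). a \<in> points \<and> b \<in> points \<and> a \<preceq> b \<and> a \<noteq> b}"
    by auto
  then show ?thesis
    using well_ordered by (auto simp: well_ordered_set_def well_order_on_def)
qed

lemma least_point:
  assumes "Q \<subseteq> points" and "Q \<noteq> {}"
  obtains m where "m \<in> Q" "\<And>q. q \<in> Q \<Longrightarrow> m \<preceq> q"
proof -
  obtain m where m: "m \<in> Q"
    "\<And>q. (q, m) \<in> {(a, b). a \<in> points \<and> b \<in> points \<and> a \<preceq> b \<and> a \<noteq> b} \<Longrightarrow> q \<notin> Q"
    using wfE_min'[OF wf_less assms(2)] by blast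
  have "m \<preceq> q" if "q \<in> Q" for q
  proof -
    have "m \<in> points" "q \<in> points" using m(1) that assms(1) by auto
    then show ?thesis using m(2)[of q] that total[of m q] refl by blast
  qed
  then show thesis using m(1) that by blast
qed

lemma downset_points: "\<lbrakk>T \<in> downsets; a \<in> T\<rbrakk> \<Longrightarrow> a \<in> points"
  using downset_lattice_subset by blast

lemma downset_closed: "\<lbrakk>T \<in> downsets; a \<in> T; b \<preceq> a; b \<in> points\<rbrakk> \<Longrightarrow> b \<in> T"
  by (rule downset_latticeD)

lemma downset_above:
  "\<lbrakk>T \<in> downsets; a \<in> T; b \<notin> T; b \<in> points\<rbrakk> \<Longrightarrow> a \<preceq> b"
  using total downset_closed downset_points by blast

lemma downsets_chain:
  assumes "T \<in> downsets" and "T' \<in> downsets"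
  shows "T \<subseteq> T' \<or> T' \<subseteq> T"
proof (rule ccontr)
  assume "\<not> (T \<subseteq> T' \<or> T' \<subseteq> T)"
  then obtain a b where ab: "a \<in> T" "a \<notin> T'" "b \<in> T'" "b \<notin> T"
    by blast
  then have "a \<preceq> b"
    using downset_above[OF assms(1)] downset_points[OF assms(2)] by blast
  then have "a \<in> T'"
    using downset_closed[OF assms(2)] downset_points[OF assms(1)] ab by blast
  then show False using ab by blast
qed

text \<open>Inclusion well-orders the down-sets of a well-order. Unless all members of the family
  coincide, take the least point \<open>m\<close> on which they disagree. A member omitting
  \<open>m\<close> contains no point of disagreement at all, hence lies in the intersection of the
  family.\<close>

lemma least_downset:
  assumes "\<Q> \<subseteq> downsets" and "\<Q> \<noteq> {}"
  obtains T where "T \<in> \<Q>" "\<And>T'. T' \<in> \<Q> \<Longrightarrow> T \<subseteq> T'"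
proof (cases "\<Union>\<Q> = \<Inter>\<Q>")
  case True
  then show thesis using that assms(2) by blast
next
  case False
  have "\<Inter>\<Q> \<subseteq> \<Union>\<Q>" using assms(2) by blast
  then have "\<Union>\<Q> - \<Inter>\<Q> \<noteq> {}" using False by blast
  moreover have "\<Union>\<Q> - \<Inter>\<Q> \<subseteq> points" using assms(1) downset_points by blast
  ultimately obtain m where m: "m \<in> \<Union>\<Q> - \<Inter>\<Q>" "\<And>q. q \<in> \<Union>\<Q> - \<Inter>\<Q> \<Longrightarrow> m \<preceq> q"
    using least_point by metis
  then obtain T where T: "T \<in> \<Q>" "m \<notin> T" by blast
  then have "T \<in> downsets" using assms(1) by blast
  have "T \<subseteq> \<Inter>\<Q>"
  proof (rule ccontr)
    assume "\<not> T \<subseteq> \<Inter>\<Q>"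
    then obtain q where "q \<in> T" "q \<in> \<Union>\<Q> - \<Inter>\<Q>" using T by blast
    then have "m \<in> T"
      using m downset_closed[OF \<open>T \<in> downsets\<close>] assms(1) downset_points by blast
    then show False using T by blast
  qed
  then show thesis using that T(1) by blast
qed

lemma wf_downsets: "wf {(T, T'). T \<in> downsets \<and> T' \<in> downsets \<and> T \<subset> T'}"
proof (rule wfI_min)
  fix T Q assume T: "T \<in> (Q :: 'i set set)"
  show "\<exists>z\<in>Q. \<forall>y. (y, z) \<in> {(T, T'). T \<in> downsets \<and> T' \<in> downsets \<and> T \<subset> T'} \<longrightarrow> y \<notin> Q"
  proof (cases "Q \<inter> downsets = {}")
    case True
    then show ?thesis using T by blast
  next
    case False
    then obtain z where "z \<in> Q \<inter> downsets" "\<And>y. y \<in> Q \<inter> downsets \<Longrightarrow> z \<subseteq> y"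
      using least_downset[of "Q \<inter> downsets"] by blast
    then show ?thesis by blast
  qed
qed

text \<open>For a down-set \<open>T\<close> containing \<open>s\<close>, the point \<open>s\<close>
  is the least element of the segment and \<open>T\<close> its down-closure. The pair is therefore
  determined by the interval and serves as its coordinates.\<close>

definition segment :: "'i \<Rightarrow> 'i set \<Rightarrow> 'i set" where
  "segment s T = {b \<in> T. s \<preceq> b}"

lemma below_downset: "s \<in> points \<Longrightarrow> {b \<in> points. \<not> s \<preceq> b} \<in> downsets"
  by (rule downset_latticeI) (auto intro: trans)

lemma segment_interval: "\<lbrakk>T \<in> downsets; s \<in> T\<rbrakk> \<Longrightarrow> segment s T \<in> intervals I"
proof -
  assume T: "T \<in> downsets" "s \<in> T"
  have "s \<in> segment s T"
    using T downset_points refl by (simp add: segment_def)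
  moreover have "b \<in> segment s T"
    if "a \<in> segment s T" "c \<in> segment s T" "b \<in> points" "a \<preceq> b" "b \<preceq> c" for a b c
    using that T downset_closed[of T c b] trans[of s a b] downset_points[of T]
    by (simp add: segment_def)
  moreover have "segment s T \<subseteq> points"
    using T downset_points by (auto simp: segment_def)
  ultimately show ?thesis
    unfolding intervals_def by blast
qed

text \<open>The least element exists by well-ordering. A greatest one may not exist, so the upper
  end is recorded by the down-closure.\<close>

lemma interval_cases:
  assumes "J \<in> intervals I"
  obtains s T where "T \<in> downsets" "s \<in> T" "J = segment s T"
proof -
  have J: "J \<noteq> {}" "J \<subseteq> points"
    and convex: "\<And>a b c. \<lbrakk>a \<in> J; c \<in> J; b \<in> points; a \<preceq> b; b \<preceq> c\<rbrakk> \<Longrightarrow> b \<in> J"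
    using assms unfolding intervals_def by blast+
  obtain s where s: "s \<in> J" "\<And>j. j \<in> J \<Longrightarrow> s \<preceq> j"
    using least_point[of J] J by metis
  define T where "T = {b \<in> points. \<exists>j\<in>J. b \<preceq> j}"
  have "T \<in> downsets"
  proof (rule downset_latticeI)
    fix x y assume "x \<in> T" "y \<in> points" "y \<preceq> x"
    then show "y \<in> T" unfolding T_def using J(2) trans by blast
  qed (auto simp: T_def)
  moreover have "s \<in> T"
    unfolding T_def using s J refl by blast
  moreover have "J = segment s T"
    unfolding T_def segment_def using s J refl convex by blast
  ultimately show thesis using that by blast
qed

text \<open>Replaces an order defined through arbitrary representing pairs by the product of two
  well-orders, the form in which all later arguments use it.\<close>

lemma interval_le_segment:
  assumes T: "T \<in> downsets" "s \<in> T" and T': "T' \<in> downsets" "s' \<in> T'"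
  shows "interval_le I (segment s T) (segment s' T') \<longleftrightarrow> s \<preceq> s' \<and> T \<subseteq> T'"
proof
  note points = downset_points[OF T] downset_points[OF T']
  assume "interval_le I (segment s T) (segment s' T')"
  then obtain A B A' B' where
    dn: "A \<in> downsets" "B \<in> downsets" "A' \<in> downsets" "B' \<in> downsets" and
    eq: "segment s T = B - A" "segment s' T' = B' - A'" and le: "A \<subseteq> A'" "B \<subseteq> B'"
    unfolding interval_le_def represents_def by blast
  have mem: "s \<in> B" "s \<notin> A" "s' \<in> B'" "s' \<notin> A'"
    using eq T T' points refl unfolding segment_def by blast+
  \<comment> \<open>\<open>A'\<close> is a down-set missing \<open>s'\<close>, so it lies below
    \<open>s'\<close>. Hence \<open>B'\<close>, which is covered by \<open>A'\<close> and the
    segment, cannot reach beyond \<open>T'\<close>.\<close>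
  have A': "A' \<subseteq> T'"
    using downset_above[OF dn(3) _ mem(4) points(2)] downset_closed[OF T'(1) T'(2)]
      downset_points[OF dn(3)] by blast
  show "s \<preceq> s' \<and> T \<subseteq> T'"
  proof
    show ss': "s \<preceq> s'"
    proof (rule ccontr)
      assume "\<not> s \<preceq> s'"
      then have "s' \<preceq> s" using total points by blast
      then have "s' \<in> B - A" using downset_closed[OF dn(2) mem(1)] points mem le by blast
      then show False using \<open>\<not> s \<preceq> s'\<close> unfolding eq(1)[symmetric] segment_def by blast
    qed
    have above: "t \<in> T'" if "t \<in> T" "s \<preceq> t" for t
    proof -
      have "t \<in> B'" using that eq(1) le unfolding segment_def by blast
      then show ?thesis using A' eq(2) unfolding segment_def by blast
    qed
    have "s \<in> T'"
      using above T(2) refl points by blast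
    then show "T \<subseteq> T'"
      using above downset_closed[OF T'(1)] total[OF points(1)] downset_points[OF T(1)]
      by (meson subsetI)
  qed
next
  assume le: "s \<preceq> s' \<and> T \<subseteq> T'"
  note points = downset_points[OF T] downset_points[OF T']
  \<comment> \<open>The canonical representation: cut off from \<open>V\<close> everything that is
    not above \<open>r\<close>. It is monotone in both coordinates.\<close>
  have rep: "represents (segment r V) {b \<in> points. \<not> r \<preceq> b} V" if "V \<in> downsets" for r V
    using downset_points[OF that] unfolding represents_def segment_def by blast
  have "{b \<in> points. \<not> s \<preceq> b} \<subseteq> {b \<in> points. \<not> s' \<preceq> b}"
    using le trans points by blast
  then show "interval_le I (segment s T) (segment s' T')"
    unfolding interval_le_def using rep[OF T(1)] rep[OF T'(1)] le
    by (intro bexI[OF _ below_downset[OF points(1)]] bexI[OF _ T(1)]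
        bexI[OF _ below_downset[OF points(2)]] bexI[OF _ T'(1)]) simp
qed

lemma segment_inject:
  assumes T: "T \<in> downsets" "s \<in> T" and T': "T' \<in> downsets" "s' \<in> T'"
    and "segment s T = segment s' T'"
  shows "s = s'" "T = T'"
proof -
  have "interval_le I (segment s T) (segment s' T')" "interval_le I (segment s' T') (segment s T)"
    using interval_le_segment[OF T T] interval_le_segment[OF T' T'] assms refl downset_points
    by auto
  then show "s = s'" "T = T'"
    unfolding interval_le_segment[OF T T'] interval_le_segment[OF T' T]
    using antisym downset_points[OF T] downset_points[OF T'] by auto
qed

lemma interval_downset_intervals: "\<lbrakk>D \<in> interval_downsets; J \<in> D\<rbrakk> \<Longrightarrow> J \<in> intervals I"
  using downset_lattice_subset[of D "interval_poset I"] by (auto simp: interval_poset_def)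

lemma interval_downset_closed:
  "\<lbrakk>D \<in> interval_downsets; segment s' T' \<in> D; T' \<in> downsets; s' \<in> T';
    T \<in> downsets; s \<in> T; s \<preceq> s'; T \<subseteq> T'\<rbrakk> \<Longrightarrow> segment s T \<in> D"
  using downset_latticeD[of D "interval_poset I" "segment s' T'" "segment s T"]
  by (simp add: interval_poset_def segment_interval interval_le_segment)

lemma segment_in_down_iff:
  assumes "T \<in> downsets" "s \<in> T" and "T' \<in> downsets" "s' \<in> T'"
  shows "segment s T \<in> down (interval_poset I) (segment s' T') \<longleftrightarrow> s \<preceq> s' \<and> T \<subseteq> T'"
  using assms by (simp add: down_def interval_poset_def segment_interval interval_le_segment)

lemma strict_down_eq:
  "strict_down (interval_poset I) J = down (interval_poset I) J - {J}"
  by (auto simp: strict_down_def down_def interval_poset_def lless_def)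

lemma interval_downsetI:
  assumes "D \<subseteq> intervals I"
    and "\<And>s T s' T'. \<lbrakk>segment s' T' \<in> D; T' \<in> downsets; s' \<in> T'; T \<in> downsets; s \<in> T;
      s \<preceq> s'; T \<subseteq> T'\<rbrakk> \<Longrightarrow> segment s T \<in> D"
  shows "D \<in> interval_downsets"
proof (rule downset_latticeI)
  show "x \<in> carrier (interval_poset I)" if "x \<in> D" for x
    using that assms(1) by (auto simp: interval_poset_def)
  fix J L assume "J \<in> D" "L \<in> carrier (interval_poset I)" "L \<sqsubseteq>\<^bsub>interval_poset I\<^esub> J"
  then have L: "J \<in> intervals I" "L \<in> intervals I" "interval_le I L J" "J \<in> D"
    using assms(1) by (auto simp: interval_poset_def)
  obtain s T where J: "T \<in> downsets" "s \<in> T" "J = segment s T"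
    using L(1) by (rule interval_cases)
  obtain s' T' where "T' \<in> downsets" "s' \<in> T'" "L = segment s' T'"
    using L(2) by (rule interval_cases)
  then show "L \<in> D"
    using J L(3,4) assms(2) interval_le_segment by simp
qed

lemma down_interval_downset:
  assumes "J \<in> intervals I"
  shows "down (interval_poset I) J \<in> interval_downsets"
proof -
  obtain s T where J: "T \<in> downsets" "s \<in> T" "J = segment s T"
    using assms by (rule interval_cases)
  show ?thesis
  proof (rule interval_downsetI)
    fix r V r' V' assume *: "segment r' V' \<in> down (interval_poset I) J" "V' \<in> downsets"
      "r' \<in> V'" "V \<in> downsets" "r \<in> V" "r \<preceq> r'" "V \<subseteq> V'"
    then have "r' \<preceq> s \<and> V' \<subseteq> T" using J by (simp add: segment_in_down_iff)
    moreover from this have "r \<preceq> s"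
      using * trans[of r r' s] downset_points J by blast
    ultimately show "segment r V \<in> down (interval_poset I) J"
      using * J by (auto simp: segment_in_down_iff)
  qed (auto simp: down_def interval_poset_def)
qed

lemma strict_down_interval_downset:
  assumes "J \<in> intervals I"
  shows "strict_down (interval_poset I) J \<in> interval_downsets"
proof -
  obtain s T where J: "T \<in> downsets" "s \<in> T" "J = segment s T"
    using assms by (rule interval_cases)
  show ?thesis
  proof (rule interval_downsetI)
    show "strict_down (interval_poset I) J \<subseteq> intervals I"
      by (auto simp: strict_down_def interval_poset_def)
    fix r V r' V' assume *: "segment r' V' \<in> strict_down (interval_poset I) J" "V' \<in> downsets"
      "r' \<in> V'" "V \<in> downsets" "r \<in> V" "r \<preceq> r'" "V \<subseteq> V'"
    then have r': "r' \<preceq> s" "V' \<subseteq> T" "segment r' V' \<noteq> J"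
      using J by (auto simp: strict_down_eq segment_in_down_iff)
    have "segment r V \<in> down (interval_poset I) J"
      using interval_downset_closed[OF down_interval_downset[OF assms] _ *(2-7)] *(1)
      by (simp add: strict_down_eq)
    \<comment> \<open>Equality would squeeze the intermediate pair \<open>(r', V')\<close> onto
      \<open>(s, T)\<close>, although its segment is strictly below \<open>J\<close>.\<close>
    moreover have "segment r V \<noteq> J"
    proof
      assume "segment r V = J"
      then have "r = s" "V = T" using segment_inject * J by blast+
      then have "r' = s" "V' = T"
        using r' * antisym[of s r'] downset_points by blast+
      then show False using r'(3) J by blast
    qed
    ultimately show "segment r V \<in> strict_down (interval_poset I) J"
      by (simp add: strict_down_eq)
  qed
qed

lemma down_self: "J \<in> intervals I \<Longrightarrow> J \<in> down (interval_poset I) J"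
  by (metis interval_cases segment_in_down_iff downset_points refl subset_refl)

end


section \<open>Subfunctors of a diagram\<close>

locale module_diagram = well_ordered I
  for I :: "('i, 'd) gorder_scheme" +
  fixes side :: side and R :: "('r, 'c) ring_scheme" and f :: "('i, 'r, 'm) diagram"
  assumes is_functor: "is_functor side R I f"
begin

lemma obj_module: "a \<in> points \<Longrightarrow> is_module side R (obj f a)"
  using is_functor by (simp add: is_functor_def)

lemma obj_operator_group: "a \<in> points \<Longrightarrow> operator_group R (obj f a)"
  by (rule is_module_operator_group[OF obj_module])

lemma arr_linear_map:
  "\<lbrakk>a \<in> points; b \<in> points; a \<preceq> b\<rbrakk> \<Longrightarrow> linear_map R (obj f a) (obj f b) (arr f a b)"
  using is_functor by (intro linear_map.intro linear_map_axioms.intro obj_operator_group)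
    (simp_all add: is_functor_def)

lemma arr_closed:
  "\<lbrakk>a \<in> points; b \<in> points; a \<preceq> b; x \<in> carrier (obj f a)\<rbrakk> \<Longrightarrow> arr f a b x \<in> carrier (obj f b)"
  by (rule linear_map.map_closed[OF arr_linear_map])

lemma arr_id: "\<lbrakk>a \<in> points; x \<in> carrier (obj f a)\<rbrakk> \<Longrightarrow> arr f a a x = x"
  using is_functor by (simp add: is_functor_def)

lemma arr_comp:
  "\<lbrakk>a \<in> points; b \<in> points; c \<in> points; a \<preceq> b; b \<preceq> c; x \<in> carrier (obj f a)\<rbrakk> \<Longrightarrow>
    arr f b c (arr f a b x) = arr f a c x"
  using is_functor unfolding is_functor_def by metis

abbreviation "subfunctors \<equiv> carrier (Sub R I f)"

abbreviation span where "span a \<equiv> submodule_span R (obj f a)"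

lemma subfunctorI:
  assumes "g \<in> extensional points" and "\<And>a. a \<in> points \<Longrightarrow> submodule (g a) R (obj f a)"
    and "\<And>a b x. \<lbrakk>a \<in> points; b \<in> points; a \<preceq> b; x \<in> g a\<rbrakk> \<Longrightarrow> arr f a b x \<in> g b"
  shows "g \<in> subfunctors"
proof -
  have "arr f a b ` g a \<subseteq> g b" if "a \<in> points" "b \<in> points" "a \<preceq> b" for a b
    using assms(3) that by blast
  then show ?thesis
    using assms(1,2) by (simp add: Sub_def)
qed

lemma subfunctor_submodule: "\<lbrakk>g \<in> subfunctors; a \<in> points\<rbrakk> \<Longrightarrow> submodule (g a) R (obj f a)"
  by (simp add: Sub_def)

lemma subfunctor_carrier: "\<lbrakk>g \<in> subfunctors; a \<in> points; x \<in> g a\<rbrakk> \<Longrightarrow> x \<in> carrier (obj f a)"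
  using submodule_subset[OF subfunctor_submodule] by blast

lemma subfunctor_arr:
  "\<lbrakk>g \<in> subfunctors; a \<in> points; b \<in> points; a \<preceq> b; x \<in> g a\<rbrakk> \<Longrightarrow> arr f a b x \<in> g b"
  unfolding Sub_def by (simp, blast)

lemma subfunctor_eqI:
  "\<lbrakk>g \<in> subfunctors; h \<in> subfunctors; \<And>a. a \<in> points \<Longrightarrow> g a = h a\<rbrakk> \<Longrightarrow> g = h"
  unfolding Sub_def by (auto intro: extensionalityI)

lemma Sub_le: "g \<sqsubseteq>\<^bsub>Sub R I f\<^esub> h \<longleftrightarrow> (\<forall>a\<in>points. g a \<subseteq> h a)"
  by (simp add: Sub_def)

lemma Sub_partial_order: "partial_order (Sub R I f)"
proof -
  have eq: "(.=\<^bsub>Sub R I f\<^esub>) = (=)"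
    by (simp add: Sub_def)
  have "g = h" if "g \<in> subfunctors" "h \<in> subfunctors" "\<forall>a\<in>points. g a \<subseteq> h a" "\<forall>a\<in>points. h a \<subseteq> g a"
    for g h
    using that subfunctor_eqI by blast
  moreover have "\<forall>a\<in>points. g a \<subseteq> k a" if "\<forall>a\<in>points. g a \<subseteq> h a" "\<forall>a\<in>points. h a \<subseteq> k a"
    for g h k :: "'i \<Rightarrow> 'm set"
    using that by blast
  ultimately show ?thesis
    by unfold_locales (simp_all add: Sub_le eq)
qed

definition join_subfunctor :: "('i \<Rightarrow> 'm set) set \<Rightarrow> 'i \<Rightarrow> 'm set" where
  "join_subfunctor A = (\<lambda>a\<in>points. span a (\<Union>g\<in>A. g a))"

text \<open>The factor \<open>carrier (obj f a)\<close> makes the empty meet the whole of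
  \<open>f\<close>.\<close>

definition meet_subfunctor :: "('i \<Rightarrow> 'm set) set \<Rightarrow> 'i \<Rightarrow> 'm set" where
  "meet_subfunctor A = (\<lambda>a\<in>points. carrier (obj f a) \<inter> (\<Inter>g\<in>A. g a))"

text \<open>The transition maps need testing on generators only: the preimage of the target span is
  a submodule, so it contains the span of the generators as soon as it contains them.\<close>

lemma span_subfunctor:
  assumes closed: "\<And>a x. \<lbrakk>a \<in> points; x \<in> Y a\<rbrakk> \<Longrightarrow> x \<in> carrier (obj f a)"
    and arr: "\<And>a b x. \<lbrakk>a \<in> points; b \<in> points; a \<preceq> b; x \<in> Y a\<rbrakk> \<Longrightarrow> arr f a b x \<in> span b (Y b)"
  shows "(\<lambda>a\<in>points. span a (Y a)) \<in> subfunctors"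
proof (rule subfunctorI)
  have Y: "Y a \<subseteq> carrier (obj f a)" if "a \<in> points" for a
    using closed that by blast
  have sub: "submodule (span a (Y a)) R (obj f a)" if "a \<in> points" for a
    using operator_group.span_submodule[OF obj_operator_group[OF that] Y[OF that]] .
  show "submodule ((\<lambda>a\<in>points. span a (Y a)) a) R (obj f a)" if "a \<in> points" for a
    using sub that by simp
  fix a b x assume ab: "a \<in> points" "b \<in> points" "a \<preceq> b" and x: "x \<in> (\<lambda>a\<in>points. span a (Y a)) a"
  interpret linear_map R "obj f a" "obj f b" "arr f a b"
    using arr_linear_map ab .
  have "span a (Y a) \<subseteq> {x \<in> carrier (obj f a). arr f a b x \<in> span b (Y b)}"
    by (rule submodule_span_least[OF preimage_submodule[OF sub]]) (use ab arr closed in auto)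
  then show "arr f a b x \<in> (\<lambda>a\<in>points. span a (Y a)) b"
    using ab x by auto
qed simp

lemma join_subfunctor_closed:
  assumes A: "A \<subseteq> subfunctors"
  shows "join_subfunctor A \<in> subfunctors"
  unfolding join_subfunctor_def
proof (rule span_subfunctor)
  show "x \<in> carrier (obj f a)" if "a \<in> points" "x \<in> (\<Union>g\<in>A. g a)" for a x
    using that A subfunctor_carrier by blast
  fix a b x assume ab: "a \<in> points" "b \<in> points" "a \<preceq> b" "x \<in> (\<Union>g\<in>A. g a)"
  then have "arr f a b x \<in> (\<Union>g\<in>A. g b)"
    using A subfunctor_arr by blast
  then show "arr f a b x \<in> span b (\<Union>g\<in>A. g b)"
    by (rule submodule_spanI)
qed

lemma meet_subfunctor_closed:
  assumes A: "A \<subseteq> subfunctors"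
  shows "meet_subfunctor A \<in> subfunctors"
  unfolding meet_subfunctor_def
proof (rule subfunctorI)
  show "submodule ((\<lambda>a\<in>points. carrier (obj f a) \<inter> (\<Inter>g\<in>A. g a)) a) R (obj f a)"
    if "a \<in> points" for a
  proof -
    interpret operator_group R "obj f a" using obj_operator_group that .
    have "submodule (\<Inter>(insert (carrier (obj f a)) ((\<lambda>g. g a) ` A))) R (obj f a)"
      using A subfunctor_submodule that carrier_submodule by (intro Inter_submodule) auto
    then show ?thesis using that by simp
  qed
  fix a b x assume ab: "a \<in> points" "b \<in> points" "a \<preceq> b"
    and x: "x \<in> (\<lambda>a\<in>points. carrier (obj f a) \<inter> (\<Inter>g\<in>A. g a)) a"
  then have "x \<in> carrier (obj f a)" "\<And>g. g \<in> A \<Longrightarrow> x \<in> g a"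
    by auto
  then show "arr f a b x \<in> (\<lambda>a\<in>points. carrier (obj f a) \<inter> (\<Inter>g\<in>A. g a)) b"
    using ab A subfunctor_arr[OF _ ab] arr_closed[OF ab] by auto
qed simp

lemma Sub_lub:
  assumes A: "A \<subseteq> subfunctors"
  shows "least (Sub R I f) (join_subfunctor A) (Upper (Sub R I f) A)"
proof -
  have "\<forall>a\<in>points. g a \<subseteq> join_subfunctor A a" if "g \<in> A" for g
    using that by (auto simp: join_subfunctor_def intro: submodule_spanI)
  moreover have "\<forall>a\<in>points. join_subfunctor A a \<subseteq> h a"
    if h: "h \<in> subfunctors" and le: "\<forall>g. g \<in> A \<and> g \<in> subfunctors \<longrightarrow> (\<forall>a\<in>points. g a \<subseteq> h a)" for h
  proof
    fix a assume a: "a \<in> points"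
    then have "(\<Union>g\<in>A. g a) \<subseteq> h a"
      using le A by blast
    then show "join_subfunctor A a \<subseteq> h a"
      using a submodule_span_least[OF subfunctor_submodule[OF h a]] by (simp add: join_subfunctor_def)
  qed
  ultimately show ?thesis
    using join_subfunctor_closed[OF A] by (simp add: least_def Upper_def Sub_le)
qed

lemma Sub_glb:
  assumes A: "A \<subseteq> subfunctors"
  shows "greatest (Sub R I f) (meet_subfunctor A) (Lower (Sub R I f) A)"
proof -
  have "\<forall>a\<in>points. meet_subfunctor A a \<subseteq> g a" if "g \<in> A" for g
    using that by (auto simp: meet_subfunctor_def)
  moreover have "\<forall>a\<in>points. h a \<subseteq> meet_subfunctor A a"
    if h: "h \<in> subfunctors" and le: "\<forall>g. g \<in> A \<and> g \<in> subfunctors \<longrightarrow> (\<forall>a\<in>points. h a \<subseteq> g a)" for h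
  proof
    fix a assume a: "a \<in> points"
    then have "h a \<subseteq> carrier (obj f a)" "h a \<subseteq> (\<Inter>g\<in>A. g a)"
      using le A subfunctor_carrier[OF h] by blast+
    then show "h a \<subseteq> meet_subfunctor A a"
      using a by (simp add: meet_subfunctor_def)
  qed
  ultimately show ?thesis
    using meet_subfunctor_closed[OF A] by (simp add: greatest_def Lower_def Sub_le)
qed

lemma Sub_complete: "complete_lattice (Sub R I f)"
proof (rule partial_order.complete_latticeI[OF Sub_partial_order])
  fix A assume A: "A \<subseteq> subfunctors"
  show "\<exists>s. least (Sub R I f) s (Upper (Sub R I f) A)"
    using Sub_lub[OF A] by blast
  show "\<exists>i. greatest (Sub R I f) i (Lower (Sub R I f) A)"
    using Sub_glb[OF A] by blast
qed

lemma Sub_sup: "A \<subseteq> subfunctors \<Longrightarrow> \<Squnion>\<^bsub>Sub R I f\<^esub> A = join_subfunctor A"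
  by (intro partial_order.sup_eqI Sub_partial_order Sub_lub)

lemma Sub_inf: "A \<subseteq> subfunctors \<Longrightarrow> \<Sqinter>\<^bsub>Sub R I f\<^esub> A = meet_subfunctor A"
  by (intro partial_order.inf_eqI Sub_partial_order Sub_glb)


section \<open>The homomorphism\<close>

definition born :: "'i \<Rightarrow> 'i \<Rightarrow> 'm set" where
  "born s a = arr f s a ` carrier (obj f s)"

text \<open>An intersection of kernels. For \<open>T = points\<close> there is no condition, and for
  \<open>a\<close> outside \<open>T\<close> the choice \<open>c = a\<close> leaves only
  zero.\<close>

definition dies :: "'i set \<Rightarrow> 'i \<Rightarrow> 'm set" where
  "dies T a = {x \<in> carrier (obj f a). \<forall>c\<in>points - T. a \<preceq> c \<longrightarrow> arr f a c x = \<zero>\<^bsub>obj f c\<^esub>}"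

lemma born_submodule:
  assumes "s \<in> points" "a \<in> points" "s \<preceq> a"
  shows "submodule (born s a) R (obj f a)"
  unfolding born_def using linear_map.image_submodule[OF arr_linear_map[OF assms]]
    operator_group.carrier_submodule[OF obj_operator_group[OF assms(1)]] by blast

lemma born_carrier: "\<lbrakk>s \<in> points; a \<in> points; s \<preceq> a; x \<in> born s a\<rbrakk> \<Longrightarrow> x \<in> carrier (obj f a)"
  using submodule_subset[OF born_submodule] by blast

lemma born_self: "a \<in> points \<Longrightarrow> born a a = carrier (obj f a)"
  unfolding born_def using arr_id by force

text \<open>Functoriality makes the image of an image an image. That this is an equality and not
  just an inclusion is the source of surjectivity in the interval quotients.\<close>

lemma arr_image_born:
  assumes "s \<in> points" "a \<in> points" "b \<in> points" "s \<preceq> a" "a \<preceq> b"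
  shows "arr f a b ` born s a = born s b"
  unfolding born_def image_image by (rule image_cong) (use assms arr_comp in auto)

lemma born_mono:
  assumes "s \<in> points" "s' \<in> points" "a \<in> points" "s \<preceq> s'" "s' \<preceq> a"
  shows "born s a \<subseteq> born s' a"
proof -
  have "born s s' \<subseteq> born s' s'"
    using born_carrier[of s s'] born_self[of s'] assms by auto
  then show ?thesis
    using arr_image_born[of s s' a] arr_image_born[of s' s' a] assms refl by blast
qed

lemma dies_carrier: "x \<in> dies T a \<Longrightarrow> x \<in> carrier (obj f a)"
  by (simp add: dies_def)

lemma dies_submodule:
  assumes a: "a \<in> points"
  shows "submodule (dies T a) R (obj f a)"
proof -
  interpret operator_group R "obj f a" using obj_operator_group[OF a] .
  \<comment> \<open>The carrier is inserted to keep the family nonempty when no point above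
    \<open>a\<close> lies outside \<open>T\<close>.\<close>
  define \<K> where "\<K> = insert (carrier (obj f a))
    ((\<lambda>c. {x \<in> carrier (obj f a). arr f a c x \<in> {\<zero>\<^bsub>obj f c\<^esub>}}) ` {c \<in> points - T. a \<preceq> c})"
  have "dies T a = \<Inter>\<K>"
    by (auto simp: dies_def \<K>_def)
  moreover have "submodule (\<Inter>\<K>) R (obj f a)"
  proof (rule Inter_submodule)
    fix N assume "N \<in> \<K>"
    then consider "N = carrier (obj f a)"
      | c where "c \<in> points" "a \<preceq> c" "N = {x \<in> carrier (obj f a). arr f a c x \<in> {\<zero>\<^bsub>obj f c\<^esub>}}"
      by (auto simp: \<K>_def)
    then show "submodule N R (obj f a)"
    proof cases
      case 1
      then show ?thesis using carrier_submodule by simp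
    next
      case (2 c)
      show ?thesis
        using linear_map.preimage_submodule[OF arr_linear_map[OF a 2(1,2)]
            operator_group.zero_submodule[OF obj_operator_group[OF 2(1)]]] 2(3) by blast
    qed
  qed (simp add: \<K>_def)
  ultimately show ?thesis by simp
qed

lemma dies_mono: "T \<subseteq> T' \<Longrightarrow> dies T a \<subseteq> dies T' a"
  by (auto simp: dies_def)

lemma dies_all: "dies points a = carrier (obj f a)"
  by (auto simp: dies_def)

lemma dies_outside: "\<lbrakk>a \<in> points; a \<notin> T; x \<in> dies T a\<rbrakk> \<Longrightarrow> x = \<zero>\<^bsub>obj f a\<^esub>"
  using refl arr_id[of a x] by (auto simp: dies_def)

lemma arr_dies:
  assumes "a \<in> points" "b \<in> points" "a \<preceq> b" "x \<in> dies T a"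
  shows "arr f a b x \<in> dies T b"
proof -
  have "arr f b c (arr f a b x) = \<zero>\<^bsub>obj f c\<^esub>" if "c \<in> points - T" "b \<preceq> c" for c
    using arr_comp[of a b c x] that assms trans[of a b c] by (auto simp: dies_def)
  then show ?thesis
    using assms arr_closed[of a b x] by (auto simp: dies_def)
qed

text \<open>A converse to \<open>arr_dies\<close> as long as \<open>b\<close> is still inside
  \<open>T\<close>: every point outside \<open>T\<close> then lies beyond \<open>b\<close>, so
  vanishing there can be checked after moving to \<open>b\<close>.\<close>

lemma dies_pullback:
  assumes "T \<in> downsets" "a \<in> points" "b \<in> T" "a \<preceq> b" "x \<in> carrier (obj f a)"
    "arr f a b x \<in> dies T b"
  shows "x \<in> dies T a"
proof -
  have "arr f a c x = \<zero>\<^bsub>obj f c\<^esub>" if c: "c \<in> points - T" "a \<preceq> c" for c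
  proof -
    have "b \<preceq> c" using c assms downset_above by blast
    then show ?thesis
      using arr_comp[of a b c x] c assms downset_points by (auto simp: dies_def)
  qed
  then show ?thesis using assms(5) by (simp add: dies_def)
qed

text \<open>
  The pairs \<open>(s, T)\<close> encode the intervals in \<open>D\<close> that contain \<open>a\<close>. For fixed \<open>a\<close> they form a
  down-set in a product of two well-orders.
\<close>

definition bars :: "'i set set \<Rightarrow> 'i \<Rightarrow> ('i \<times> 'i set) set" where
  "bars D a = {(s, T). s \<in> points \<and> T \<in> downsets \<and> s \<preceq> a \<and> a \<in> T \<and> segment s T \<in> D}"

definition generators :: "'i set set \<Rightarrow> 'i \<Rightarrow> 'm set" where
  "generators D a = (\<Union>(s, T)\<in>bars D a. born s a \<inter> dies T a)"

definition interval_sum :: "'i set set \<Rightarrow> 'i \<Rightarrow> 'm set" where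
  "interval_sum D = (\<lambda>a\<in>points. span a (generators D a))"

lemma bars_iff:
  "(s, T) \<in> bars D a \<longleftrightarrow> s \<in> points \<and> T \<in> downsets \<and> s \<preceq> a \<and> a \<in> T \<and> segment s T \<in> D"
  by (simp add: bars_def)

lemma bars_points:
  assumes "(s, T) \<in> bars D a"
  shows "s \<in> T" "a \<in> points"
  using assms downset_points[of T a] downset_closed[of T a s] by (auto simp: bars_iff)

text \<open>Lowering \<open>s\<close> keeps the bar over \<open>a\<close> automatically, but
  shrinking \<open>T\<close> could lose \<open>a\<close>; hence the hypothesis
  \<open>a \<in> T\<close>.\<close>

lemma bars_closed:
  assumes "D \<in> interval_downsets" "(s', T') \<in> bars D a"
    and "s \<in> points" "T \<in> downsets" "a \<in> T" "s \<preceq> s'" "T \<subseteq> T'"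
  shows "(s, T) \<in> bars D a"
proof -
  have "s \<preceq> a"
    using assms trans[of s s' a] bars_points[OF assms(2)] by (simp add: bars_iff)
  moreover have "s \<in> T"
    using downset_closed[OF assms(4,5)] assms(3) calculation by blast
  ultimately show ?thesis
    using assms interval_downset_closed[of D s' T' T s] bars_points[OF assms(2)] by (simp add: bars_iff)
qed

lemma generatorsI: "\<lbrakk>(s, T) \<in> bars D a; x \<in> born s a; x \<in> dies T a\<rbrakk> \<Longrightarrow> x \<in> generators D a"
  by (auto simp: generators_def)

lemma generatorsE:
  assumes "x \<in> generators D a"
  obtains s T where "(s, T) \<in> bars D a" "x \<in> born s a" "x \<in> dies T a"
  using assms by (auto simp: generators_def)

lemma generators_carrier: "generators D a \<subseteq> carrier (obj f a)"
  using dies_carrier by (auto elim: generatorsE)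

lemma generators_in_interval_sum: "a \<in> points \<Longrightarrow> generators D a \<subseteq> interval_sum D a"
  by (auto simp: interval_sum_def intro: submodule_spanI)

lemma interval_sum_submodule: "a \<in> points \<Longrightarrow> submodule (interval_sum D a) R (obj f a)"
  using operator_group.span_submodule[OF obj_operator_group generators_carrier]
  by (simp add: interval_sum_def)

lemma interval_sum_least:
  "\<lbrakk>a \<in> points; submodule N R (obj f a); generators D a \<subseteq> N\<rbrakk> \<Longrightarrow> interval_sum D a \<subseteq> N"
  using submodule_span_least by (simp add: interval_sum_def)

lemma interval_sum_mono:
  assumes "a \<in> points" "bars D a \<subseteq> bars D' a"
  shows "interval_sum D a \<subseteq> interval_sum D' a"
proof -
  have "generators D a \<subseteq> generators D' a"
    using assms(2) by (auto simp: generators_def)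
  then show ?thesis
    using assms(1) submodule_span_mono by (simp add: interval_sum_def)
qed

text \<open>Along an arrow a generator either stays within its bar, and is a generator for the same
  bar at the new point, or leaves the bar and becomes zero.\<close>

lemma interval_sum_subfunctor: "interval_sum D \<in> subfunctors"
  unfolding interval_sum_def
proof (rule span_subfunctor)
  show "x \<in> carrier (obj f a)" if "x \<in> generators D a" for a x
    using that generators_carrier by blast
  fix a b x assume ab: "a \<in> points" "b \<in> points" "a \<preceq> b" and x: "x \<in> generators D a"
  obtain s T where st: "(s, T) \<in> bars D a" "x \<in> born s a" "x \<in> dies T a"
    using x by (rule generatorsE)
  have y: "arr f a b x \<in> born s b" "arr f a b x \<in> dies T b"
    using arr_image_born[of s a b] arr_dies[OF ab st(3)] st(1,2) ab by (auto simp: bars_iff)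
  show "arr f a b x \<in> span b (generators D b)"
  proof (cases "b \<in> T")
    case True
    then have "(s, T) \<in> bars D b"
      using st(1) ab trans[of s a b] by (auto simp: bars_iff)
    then show ?thesis
      using y by (intro submodule_spanI generatorsI)
  next
    case False
    then have "arr f a b x = \<zero>\<^bsub>obj f b\<^esub>"
      using dies_outside ab y by blast
    then show ?thesis
      using submodule_zero[OF interval_sum_submodule[OF ab(2)]] ab by (simp add: interval_sum_def)
  qed
qed

section \<open>Preservation of arbitrary joins and meets\<close>

lemma interval_sum_Union:
  assumes "A \<subseteq> interval_downsets"
  shows "interval_sum (\<Union>A) = join_subfunctor (interval_sum ` A)"
proof (rule subfunctor_eqI[OF interval_sum_subfunctor join_subfunctor_closed])
  show "interval_sum ` A \<subseteq> subfunctors"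
    using interval_sum_subfunctor by auto
  fix a assume a: "a \<in> points"
  have join: "join_subfunctor (interval_sum ` A) a = span a (\<Union>D\<in>A. interval_sum D a)"
    using a by (simp add: join_subfunctor_def)
  show "interval_sum (\<Union>A) a = join_subfunctor (interval_sum ` A) a"
  proof
    have "generators (\<Union>A) a \<subseteq> (\<Union>D\<in>A. interval_sum D a)"
    proof
      fix x assume "x \<in> generators (\<Union>A) a"
      then obtain s T where st: "(s, T) \<in> bars (\<Union>A) a" "x \<in> born s a" "x \<in> dies T a"
        by (rule generatorsE)
      then obtain D where "D \<in> A" "(s, T) \<in> bars D a"
        by (auto simp: bars_iff)
      moreover from this have "x \<in> interval_sum D a"
        using generatorsI[OF _ st(2,3)] generators_in_interval_sum[OF a] by blast
      ultimately show "x \<in> (\<Union>D\<in>A. interval_sum D a)"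
        by blast
    qed
    then show "interval_sum (\<Union>A) a \<subseteq> join_subfunctor (interval_sum ` A) a"
      unfolding join using a submodule_span_mono by (simp add: interval_sum_def)
    have "interval_sum D a \<subseteq> interval_sum (\<Union>A) a" if "D \<in> A" for D
      using that by (intro interval_sum_mono[OF a]) (auto simp: bars_def)
    then show "join_subfunctor (interval_sum ` A) a \<subseteq> interval_sum (\<Union>A) a"
      unfolding join by (intro submodule_span_least interval_sum_submodule a) blast
  qed
qed

text \<open>
  The elements of \<open>N\<^sub>1 + N\<^sub>2\<close>, where \<open>N\<^sub>1\<close> collects what is born before \<open>s\<close> and \<open>N\<^sub>2\<close> what dies
  within a bar of \<open>D\<close> starting at \<open>s\<close>, form a submodule that contains all generators of \<open>D\<close>:
  a bar starting at or after \<open>s\<close> may be prolonged to one starting at \<open>s\<close>.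
\<close>

lemma interval_sum_split:
  assumes D: "D \<in> interval_downsets" and s: "s \<in> points" and a: "a \<in> points" and sa: "s \<preceq> a"
    and x: "x \<in> interval_sum D a" "x \<in> born s a"
  obtains y z where "x = y \<oplus>\<^bsub>obj f a\<^esub> z" "y \<in> interval_sum D a"
    "y = \<zero>\<^bsub>obj f a\<^esub> \<or> (\<exists>r\<in>points. r \<preceq> s \<and> r \<noteq> s \<and> y \<in> born r a)"
    "z = \<zero>\<^bsub>obj f a\<^esub> \<or> (\<exists>T. (s, T) \<in> bars D a \<and> z \<in> born s a \<and> z \<in> dies T a)"
proof -
  interpret operator_group R "obj f a" using obj_operator_group[OF a] .
  \<comment> \<open>Zero is inserted because there may be no point before \<open>s\<close>. The
    intersection with the sum keeps track of the fact that generators born before \<open>s\<close>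
    stay in \<open>interval_sum D a\<close>, as the summand \<open>y\<close> must.\<close>
  define N\<^sub>1 where "N\<^sub>1 = interval_sum D a \<inter>
    \<Union>(insert {\<zero>\<^bsub>obj f a\<^esub>} ((\<lambda>r. born r a) ` {r \<in> points. r \<preceq> s \<and> r \<noteq> s}))"
  define N\<^sub>2 where "N\<^sub>2 = \<Union>(insert {\<zero>\<^bsub>obj f a\<^esub>} ((\<lambda>T. dies T a) ` {T. (s, T) \<in> bars D a}))"
  have before: "submodule (born r a) R (obj f a)" if "r \<in> points" "r \<preceq> s" for r
    using born_submodule that trans[of r s a] s a sa by blast
  have N1: "submodule N\<^sub>1 R (obj f a)"
    unfolding N\<^sub>1_def
  proof (rule Int_submodule[OF interval_sum_submodule[OF a] submodule_chain_Union])
    fix N assume "N \<in> insert {\<zero>\<^bsub>obj f a\<^esub>} ((\<lambda>r. born r a) ` {r \<in> points. r \<preceq> s \<and> r \<noteq> s})"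
    then show N: "submodule N R (obj f a)"
      using zero_submodule before by blast
    fix N' assume "N' \<in> insert {\<zero>\<^bsub>obj f a\<^esub>} ((\<lambda>r. born r a) ` {r \<in> points. r \<preceq> s \<and> r \<noteq> s})"
    then consider "N = {\<zero>\<^bsub>obj f a\<^esub>}" "submodule N' R (obj f a)" | "N' = {\<zero>\<^bsub>obj f a\<^esub>}"
      | r r' where "N = born r a" "N' = born r' a" "r \<in> points" "r' \<in> points" "r \<preceq> s" "r' \<preceq> s"
      using \<open>N \<in> _\<close> before zero_submodule by blast
    then show "N \<subseteq> N' \<or> N' \<subseteq> N"
    proof cases
      case 3
      have "r \<preceq> a" "r' \<preceq> a"
        using 3 trans s a sa by blast+
      then show ?thesis
        using 3 total[of r r'] born_mono[of r r' a] born_mono[of r' r a] a by blast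
    qed (use N submodule_zero in blast)+
  qed simp
  have N2: "submodule N\<^sub>2 R (obj f a)"
    unfolding N\<^sub>2_def
  proof (rule submodule_chain_Union)
    fix N assume "N \<in> insert {\<zero>\<^bsub>obj f a\<^esub>} ((\<lambda>T. dies T a) ` {T. (s, T) \<in> bars D a})"
    then show N: "submodule N R (obj f a)"
      using zero_submodule dies_submodule[OF a] by blast
    fix N' assume "N' \<in> insert {\<zero>\<^bsub>obj f a\<^esub>} ((\<lambda>T. dies T a) ` {T. (s, T) \<in> bars D a})"
    then consider "N = {\<zero>\<^bsub>obj f a\<^esub>}" "submodule N' R (obj f a)" | "N' = {\<zero>\<^bsub>obj f a\<^esub>}"
      | T T' where "N = dies T a" "N' = dies T' a" "(s, T) \<in> bars D a" "(s, T') \<in> bars D a"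
      using \<open>N \<in> _\<close> zero_submodule dies_submodule[OF a] by blast
    then show "N \<subseteq> N' \<or> N' \<subseteq> N"
    proof cases
      case 3
      then have "T \<subseteq> T' \<or> T' \<subseteq> T"
        using downsets_chain by (simp add: bars_iff)
      then show ?thesis
        using 3 dies_mono by blast
    qed (use N submodule_zero in blast)+
  qed simp
  have zero: "\<zero>\<^bsub>obj f a\<^esub> \<in> N\<^sub>1" "\<zero>\<^bsub>obj f a\<^esub> \<in> N\<^sub>2"
    using submodule_zero N1 N2 by blast+
  have "generators D a \<subseteq> {y \<oplus>\<^bsub>obj f a\<^esub> z | y z. y \<in> N\<^sub>1 \<and> z \<in> N\<^sub>2}"
  proof
    fix w assume w: "w \<in> generators D a"
    then have wc: "w \<in> carrier (obj f a)" using generators_carrier by blast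
    obtain s' T' where st: "(s', T') \<in> bars D a" "w \<in> born s' a" "w \<in> dies T' a"
      using w by (rule generatorsE)
    show "w \<in> {y \<oplus>\<^bsub>obj f a\<^esub> z | y z. y \<in> N\<^sub>1 \<and> z \<in> N\<^sub>2}"
    proof (cases "s \<preceq> s'")
      case True
      then have "(s, T') \<in> bars D a"
        using bars_closed[OF D st(1) s, of T'] st(1) by (simp add: bars_iff[of s'])
      then have "w \<in> N\<^sub>2" using st(3) by (auto simp: N\<^sub>2_def)
      moreover have "w = \<zero>\<^bsub>obj f a\<^esub> \<oplus>\<^bsub>obj f a\<^esub> w" using wc by simp
      ultimately show ?thesis using zero by blast
    next
      case False
      then have "s' \<preceq> s" "s' \<noteq> s" "s' \<in> points"
        using total[of s s'] refl s st(1) by (auto simp: bars_iff)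
      then have "w \<in> N\<^sub>1"
        using st w generators_in_interval_sum[OF a] by (auto simp: N\<^sub>1_def)
      moreover have "w = w \<oplus>\<^bsub>obj f a\<^esub> \<zero>\<^bsub>obj f a\<^esub>" using wc by simp
      ultimately show ?thesis using zero by blast
    qed
  qed
  then have "x \<in> {y \<oplus>\<^bsub>obj f a\<^esub> z | y z. y \<in> N\<^sub>1 \<and> z \<in> N\<^sub>2}"
    using interval_sum_least[OF a sum_submodule[OF N1 N2]] x(1) by blast
  then obtain y z where yz: "x = y \<oplus>\<^bsub>obj f a\<^esub> z" "y \<in> N\<^sub>1" "z \<in> N\<^sub>2" by blast
  have y: "y = \<zero>\<^bsub>obj f a\<^esub> \<or> (\<exists>r\<in>points. r \<preceq> s \<and> r \<noteq> s \<and> y \<in> born r a)"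
    using yz(2) by (auto simp: N\<^sub>1_def)
  have z: "z = \<zero>\<^bsub>obj f a\<^esub> \<or> (\<exists>T. (s, T) \<in> bars D a \<and> z \<in> dies T a)"
    using yz(3) by (auto simp: N\<^sub>2_def)
  \<comment> \<open>\<open>N\<^sub>2\<close> records death only. That \<open>z\<close> is born by
    \<open>s\<close> comes back from \<open>z = x - y\<close>, where \<open>x\<close> and
    \<open>y\<close> both are.\<close>
  have "y \<in> born s a"
    using y born_mono[of _ s a] submodule_zero[OF born_submodule[OF s a sa]] s a sa by blast
  moreover have "y \<in> carrier (obj f a)" "z \<in> carrier (obj f a)"
    using submodule_subset N1 N2 yz by blast+
  then have "z = x \<ominus>\<^bsub>obj f a\<^esub> y"
    using yz(1) a_comm[of y z] by (simp add: a_minus_def a_assoc r_neg)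
  ultimately have "z \<in> born s a"
    using submodule_minus[OF born_submodule[OF s a sa]] x(2) by blast
  then show thesis
    using that yz y z by (auto simp: N\<^sub>1_def)
qed

text \<open>The induction treats all elements born by \<open>s\<close> at once, since the remainder
  \<open>y\<close> of \<open>x\<close> differs from \<open>x\<close>. The splitting is made for one
  member \<open>D\<^sub>0\<close> only; its choice ensures that the same \<open>y\<close> and
  \<open>z\<close> work for every other member.\<close>

lemma interval_sum_Inter:
  assumes \<A>: "\<A> \<subseteq> interval_downsets" "\<A> \<noteq> {}" and a: "a \<in> points"
    and x: "\<And>D. D \<in> \<A> \<Longrightarrow> x \<in> interval_sum D a"
  shows "x \<in> interval_sum (\<Inter>\<A>) a"
proof -
  interpret operator_group R "obj f a" using obj_operator_group[OF a] .
  have "\<forall>x. s \<in> points \<longrightarrow> s \<preceq> a \<longrightarrow> x \<in> born s a \<longrightarrow> (\<forall>D\<in>\<A>. x \<in> interval_sum D a) \<longrightarrow>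
      x \<in> interval_sum (\<Inter>\<A>) a" for s
  proof (induction s rule: wf_induct_rule[OF wf_less])
    case (1 s)
    show ?case
    proof (intro allI impI)
      fix x assume s: "s \<in> points" and sa: "s \<preceq> a" and xs: "x \<in> born s a"
        and x: "\<forall>D\<in>\<A>. x \<in> interval_sum D a"
      obtain D\<^sub>0 where D0: "D\<^sub>0 \<in> \<A>"
        and least: "\<And>T D. \<lbrakk>(s, T) \<in> bars D\<^sub>0 a; D \<in> \<A>\<rbrakk> \<Longrightarrow> (s, T) \<in> bars D a"
      proof (cases "\<exists>T\<in>downsets. a \<in> T \<and> (\<exists>D\<in>\<A>. (s, T) \<notin> bars D a)")
        \<comment> \<open>No end \<open>T\<close> over \<open>a\<close> is refused by any member, so
          any member will do.\<close>
        case False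
        obtain D\<^sub>0 where "D\<^sub>0 \<in> \<A>" using \<A>(2) by blast
        moreover have "(s, T) \<in> bars D a" if "(s, T) \<in> bars D\<^sub>0 a" "D \<in> \<A>" for T D
          using False that by (simp add: bars_iff[of s T D\<^sub>0])
        ultimately show thesis using that by blast
      next
        case True
        \<comment> \<open>The ends refused by some member for bars starting at \<open>s\<close>. A
          member refusing the least of them, \<open>T\<^sub>0\<close>, has only bars from
          \<open>s\<close> ending before \<open>T\<^sub>0\<close>, and no member refuses
          those.\<close>
        define \<Q> where "\<Q> = {T \<in> downsets. a \<in> T \<and> (\<exists>D\<in>\<A>. (s, T) \<notin> bars D a)}"
        have "\<Q> \<subseteq> downsets" "\<Q> \<noteq> {}" using True by (auto simp: \<Q>_def)
        then obtain T\<^sub>0 where T0: "T\<^sub>0 \<in> \<Q>" "\<And>T. T \<in> \<Q> \<Longrightarrow> T\<^sub>0 \<subseteq> T"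
          using least_downset by metis
        obtain D\<^sub>0 where D0: "D\<^sub>0 \<in> \<A>" "(s, T\<^sub>0) \<notin> bars D\<^sub>0 a"
          using T0(1) by (auto simp: \<Q>_def)
        have "(s, T) \<in> bars D a" if T: "(s, T) \<in> bars D\<^sub>0 a" "D \<in> \<A>" for T D
        proof (rule ccontr)
          assume "(s, T) \<notin> bars D a"
          then have "T \<in> \<Q>" using T by (auto simp: \<Q>_def bars_iff)
          then have "T\<^sub>0 \<subseteq> T" using T0(2) by blast
          moreover have "T\<^sub>0 \<in> downsets" "a \<in> T\<^sub>0" using T0(1) by (auto simp: \<Q>_def)
          ultimately have "(s, T\<^sub>0) \<in> bars D\<^sub>0 a"
            using bars_closed[OF _ T(1) s] D0(1) \<A>(1) refl[OF s] by blast
          then show False using D0(2) by blast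
        qed
        then show thesis using that D0(1) by blast
      qed
      have "D\<^sub>0 \<in> interval_downsets" using D0 \<A>(1) by blast
      then obtain y z where xyz: "x = y \<oplus>\<^bsub>obj f a\<^esub> z" and y: "y \<in> interval_sum D\<^sub>0 a"
        "y = \<zero>\<^bsub>obj f a\<^esub> \<or> (\<exists>r\<in>points. r \<preceq> s \<and> r \<noteq> s \<and> y \<in> born r a)"
        and z: "z = \<zero>\<^bsub>obj f a\<^esub> \<or> (\<exists>T. (s, T) \<in> bars D\<^sub>0 a \<and> z \<in> born s a \<and> z \<in> dies T a)"
        using interval_sum_split[OF _ s a sa _ xs] x D0 by metis
      have z_in: "z \<in> interval_sum D a" if "\<And>T. (s, T) \<in> bars D\<^sub>0 a \<Longrightarrow> (s, T) \<in> bars D a" for D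
        using z
      proof
        assume "z = \<zero>\<^bsub>obj f a\<^esub>"
        then show ?thesis using submodule_zero[OF interval_sum_submodule[OF a]] by simp
      next
        assume "\<exists>T. (s, T) \<in> bars D\<^sub>0 a \<and> z \<in> born s a \<and> z \<in> dies T a"
        then show ?thesis
          using that generatorsI generators_in_interval_sum[OF a] by blast
      qed
      have carr: "x \<in> carrier (obj f a)" "y \<in> carrier (obj f a)" "z \<in> carrier (obj f a)"
        using submodule_subset[OF interval_sum_submodule[OF a]] y(1) z_in[of D\<^sub>0] x D0 by blast+
      \<comment> \<open>Both \<open>x\<close> and \<open>z\<close> lie in the sum for
        \<open>D\<close>, the latter by the choice of \<open>D\<^sub>0\<close>; so their difference
        does, and the induction hypothesis applies to \<open>y\<close> with an earlier
        birth.\<close>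
      have y_in: "y \<in> interval_sum D a" if "D \<in> \<A>" for D
      proof -
        have "y = x \<ominus>\<^bsub>obj f a\<^esub> z"
          using xyz carr by (simp add: a_minus_def a_assoc r_neg)
        then show ?thesis
          using submodule_minus[OF interval_sum_submodule[OF a]] x z_in least that by blast
      qed
      have "y \<in> interval_sum (\<Inter>\<A>) a"
        using y(2)
      proof
        assume "y = \<zero>\<^bsub>obj f a\<^esub>"
        then show ?thesis using submodule_zero[OF interval_sum_submodule[OF a]] by simp
      next
        assume "\<exists>r\<in>points. r \<preceq> s \<and> r \<noteq> s \<and> y \<in> born r a"
        then obtain r where r: "r \<in> points" "r \<preceq> s" "r \<noteq> s" "y \<in> born r a" by blast
        moreover have "r \<preceq> a" using r trans s a sa by blast
        ultimately show ?thesis using 1[of r] s y_in by blast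
      qed
      moreover have "z \<in> interval_sum (\<Inter>\<A>) a"
      proof (rule z_in)
        fix T assume T: "(s, T) \<in> bars D\<^sub>0 a"
        then have "segment s T \<in> D" if "D \<in> \<A>" for D
          using least[OF T that] by (simp add: bars_iff)
        then show "(s, T) \<in> bars (\<Inter>\<A>) a"
          using T by (simp add: bars_iff)
      qed
      ultimately show "x \<in> interval_sum (\<Inter>\<A>) a"
        using xyz submodule_add[OF interval_sum_submodule[OF a]] by blast
    qed
  qed
  \<comment> \<open>The induction is used at \<open>s = a\<close>, since everything at
    \<open>a\<close> is born by \<open>a\<close>.\<close>
  moreover obtain D where "D \<in> \<A>" using \<A>(2) by blast
  then have "x \<in> born a a"
    using x born_self[OF a] submodule_subset[OF interval_sum_submodule[OF a]] by blast
  ultimately show ?thesis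
    using a refl x by blast
qed

lemma interval_sum_all:
  assumes a: "a \<in> points"
  shows "interval_sum (intervals I) a = carrier (obj f a)"
proof -
  \<comment> \<open>The bar that starts at \<open>a\<close> and never ends imposes neither a birth
    nor a death condition at \<open>a\<close>.\<close>
  have "(a, points) \<in> bars (intervals I) a"
    using a refl[OF a] downset_lattice_carrier[of I] segment_interval[OF _ a] by (simp add: bars_iff)
  then have "carrier (obj f a) \<subseteq> generators (intervals I) a"
    using born_self[OF a] dies_all generatorsI by blast
  then show ?thesis
    using generators_in_interval_sum[OF a] submodule_subset[OF interval_sum_submodule[OF a]] by blast
qed

lemma interval_sum_meet:
  assumes A: "A \<subseteq> interval_downsets"
  shows "interval_sum (intervals I \<inter> \<Inter>A) = meet_subfunctor (interval_sum ` A)"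
proof (rule subfunctor_eqI[OF interval_sum_subfunctor meet_subfunctor_closed])
  show "interval_sum ` A \<subseteq> subfunctors"
    using interval_sum_subfunctor by auto
  fix a assume a: "a \<in> points"
  show "interval_sum (intervals I \<inter> \<Inter>A) a = meet_subfunctor (interval_sum ` A) a"
  \<comment> \<open>The empty meet asks that the top go to the top; it is not covered by the
    argument for nonempty families.\<close>
  proof (cases "A = {}")
    case True
    then show ?thesis using a interval_sum_all by (simp add: meet_subfunctor_def)
  next
    case False
    then have "intervals I \<inter> \<Inter>A = \<Inter>A"
      using A interval_downset_intervals by blast
    moreover have below: "interval_sum (\<Inter>A) a \<subseteq> interval_sum D a" if "D \<in> A" for D
      using that by (intro interval_sum_mono[OF a]) (auto simp: bars_def)
    have "interval_sum (\<Inter>A) a = carrier (obj f a) \<inter> (\<Inter>D\<in>A. interval_sum D a)"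
    proof (intro equalityI subsetI)
      fix x assume "x \<in> carrier (obj f a) \<inter> (\<Inter>D\<in>A. interval_sum D a)"
      then show "x \<in> interval_sum (\<Inter>A) a"
        using interval_sum_Inter[OF A False a] by blast
    next
      fix x assume "x \<in> interval_sum (\<Inter>A) a"
      then show "x \<in> carrier (obj f a) \<inter> (\<Inter>D\<in>A. interval_sum D a)"
        using submodule_subset[OF interval_sum_submodule[OF a]] below by blast
    qed
    ultimately show ?thesis
      using a by (simp add: meet_subfunctor_def)
  qed
qed

lemma interval_sum_hom:
  "restrict interval_sum interval_downsets
    \<in> complete_lattice_hom (downset_lattice (interval_poset I)) (Sub R I f)"
proof -
  let ?\<Omega> = "restrict interval_sum interval_downsets"
  have image: "?\<Omega> ` A = interval_sum ` A" if "A \<subseteq> interval_downsets" for A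
    using that by (intro image_cong) auto
  have sub: "interval_sum ` A \<subseteq> subfunctors" for A
    using interval_sum_subfunctor by auto
  have "sup_pres (downset_lattice (interval_poset I)) (Sub R I f) ?\<Omega>"
    unfolding sup_pres_def using downset_lattice_complete Sub_complete image sub
    by (simp add: downset_lattice_sup downset_lattice_Union Sub_sup interval_sum_Union)
  moreover have "inf_pres (downset_lattice (interval_poset I)) (Sub R I f) ?\<Omega>"
    unfolding inf_pres_def
    using downset_lattice_complete Sub_complete image sub downset_lattice_Inter[of _ "interval_poset I"]
    by (simp add: downset_lattice_inf Sub_inf interval_sum_meet interval_poset_def)
  ultimately show ?thesis
    unfolding complete_lattice_hom_def using interval_sum_subfunctor by auto
qed

end


section \<open>The quotients\<close>

text \<open>Translates membership of a quotient in \<open>interval_diagrams\<close> into statements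
  about elements of \<open>g\<close> and \<open>h\<close>. It is used in both directions: to verify
  the condition for the constructed map and to exploit it for an arbitrary one.\<close>

locale nested_subfunctors = module_diagram +
  fixes g h
  assumes sub: "g \<in> subfunctors" "h \<in> subfunctors"
    and nested: "\<And>a. a \<in> points \<Longrightarrow> h a \<subseteq> g a"
begin

abbreviation "quot \<equiv> quotient_diagram f g h"

abbreviation coset where "coset a x \<equiv> h a +>\<^bsub>obj f a\<^esub> x"

lemmas g_carrier = subfunctor_carrier[OF sub(1)]
lemmas h_submodule = subfunctor_submodule[OF sub(2)]

lemma quot_carrier: "carrier (obj quot a) = coset a ` g a"
  by (simp add: quotient_diagram_def quotient_module_carrier)

lemma quot_zero: "\<zero>\<^bsub>obj quot a\<^esub> = h a"
  by (simp add: quotient_diagram_def quotient_module_def)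

lemma quot_add: "\<lbrakk>a \<in> points; x \<in> g a; y \<in> g a\<rbrakk> \<Longrightarrow>
    coset a x \<oplus>\<^bsub>obj quot a\<^esub> coset a y = coset a (x \<oplus>\<^bsub>obj f a\<^esub> y)"
  using operator_group.quotient_add[OF obj_operator_group h_submodule] g_carrier
  by (simp add: quotient_diagram_def)

lemma quot_smult: "\<lbrakk>a \<in> points; x \<in> g a; r \<in> carrier R\<rbrakk> \<Longrightarrow>
    r \<odot>\<^bsub>obj quot a\<^esub> coset a x = coset a (r \<odot>\<^bsub>obj f a\<^esub> x)"
  using operator_group.quotient_smult[OF obj_operator_group h_submodule] g_carrier
  by (simp add: quotient_diagram_def)

lemma quot_arr:
  assumes "a \<in> points" "b \<in> points" "a \<preceq> b" "x \<in> g a"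
  shows "arr quot a b (coset a x) = coset b (arr f a b x)"
proof -
  interpret linear_map R "obj f a" "obj f b" "arr f a b" using arr_linear_map assms by blast
  have "arr f a b ` h a \<subseteq> h b"
    using subfunctor_arr[OF sub(2)] assms by blast
  then have "h b <+>\<^bsub>obj f b\<^esub> arr f a b ` coset a x = coset b (arr f a b x)"
    using assms g_carrier
    by (intro coset_image[OF M.abelian_group_axioms N.operator_group_axioms h_submodule h_submodule])
      (auto simp: map_add map_closed)
  then show ?thesis
    by (simp add: quotient_diagram_def)
qed

lemma coset_eq_h_iff: "\<lbrakk>a \<in> points; x \<in> g a\<rbrakk> \<Longrightarrow> coset a x = h a \<longleftrightarrow> x \<in> h a"
  using operator_group.coset_eq_self_iff[OF obj_operator_group h_submodule] g_carrier by blast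

lemma coset_eq_coset_iff: "\<lbrakk>a \<in> points; x \<in> g a; y \<in> g a\<rbrakk> \<Longrightarrow>
    coset a x = coset a y \<longleftrightarrow> x \<ominus>\<^bsub>obj f a\<^esub> y \<in> h a"
  using operator_group.coset_eq_iff[OF obj_operator_group h_submodule] g_carrier by blast

lemma quot_arr_linear:
  assumes ab: "a \<in> points" "b \<in> points" "a \<preceq> b"
  shows "arr quot a b \<in> linear_maps R (obj quot a) (obj quot b)"
proof -
  interpret linear_map R "obj f a" "obj f b" "arr f a b" using arr_linear_map ab by blast
  note g = subfunctor_submodule[OF sub(1)]
  note arr_g = subfunctor_arr[OF sub(1) ab]
  have "arr quot a b A \<in> carrier (obj quot b)" if "A \<in> carrier (obj quot a)" for A
    using that quot_arr[OF ab] arr_g by (auto simp: quot_carrier)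
  moreover have "arr quot a b (A \<oplus>\<^bsub>obj quot a\<^esub> B) = arr quot a b A \<oplus>\<^bsub>obj quot b\<^esub> arr quot a b B"
    if AB: "A \<in> carrier (obj quot a)" "B \<in> carrier (obj quot a)" for A B
  proof -
    obtain x y where xy: "x \<in> g a" "A = coset a x" "y \<in> g a" "B = coset a y"
      using AB by (auto simp: quot_carrier)
    then show ?thesis
      using ab arr_g submodule_add[OF g[OF ab(1)]] g_carrier[OF ab(1)]
      by (simp add: quot_add quot_arr map_add)
  qed
  moreover have "arr quot a b (r \<odot>\<^bsub>obj quot a\<^esub> A) = r \<odot>\<^bsub>obj quot b\<^esub> arr quot a b A"
    if rA: "r \<in> carrier R" "A \<in> carrier (obj quot a)" for r A
  proof -
    obtain x where x: "x \<in> g a" "A = coset a x"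
      using rA by (auto simp: quot_carrier)
    then show ?thesis
      using ab arr_g submodule.smult_closed[OF g[OF ab(1)]] g_carrier[OF ab(1)] rA(1)
      by (simp add: quot_smult quot_arr map_smult)
  qed
  ultimately show ?thesis
    by (simp add: linear_maps_def)
qed

lemma quot_functor: "is_functor side R I quot"
proof -
  have "is_module side R (obj quot a)" if "a \<in> points" for a
    using quotient_is_module[OF obj_module subfunctor_submodule[OF sub(1)] h_submodule nested] that
    by (simp add: quotient_diagram_def)
  moreover have "arr quot a a A = A" if "a \<in> points" "A \<in> carrier (obj quot a)" for a A
    using that quot_arr[of a a] arr_id g_carrier refl by (auto simp: quot_carrier)
  moreover have "arr quot a c A = arr quot b c (arr quot a b A)"
    if abc: "a \<in> points" "b \<in> points" "c \<in> points" "a \<preceq> b" "b \<preceq> c"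
      and A: "A \<in> carrier (obj quot a)" for a b c A
  proof -
    obtain x where "x \<in> g a" "A = coset a x"
      using A by (auto simp: quot_carrier)
    then show ?thesis
      using abc quot_arr arr_comp[of a b c x] trans[of a b c] g_carrier[of a x]
        subfunctor_arr[OF sub(1), of a b x] by simp
  qed
  ultimately show ?thesis
    using quot_arr_linear by (simp add: is_functor_def)
qed

lemma quot_zero_iff:
  assumes "a \<in> points"
  shows "carrier (obj quot a) = {\<zero>\<^bsub>obj quot a\<^esub>} \<longleftrightarrow> g a \<subseteq> h a"
proof
  assume *: "carrier (obj quot a) = {\<zero>\<^bsub>obj quot a\<^esub>}"
  show "g a \<subseteq> h a"
  proof
    fix x assume x: "x \<in> g a"
    then have "coset a x = h a"
      using * by (auto simp: quot_carrier quot_zero)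
    then show "x \<in> h a" using coset_eq_h_iff assms x by blast
  qed
next
  assume "g a \<subseteq> h a"
  then have "coset a x = h a" if "x \<in> g a" for x
    using coset_eq_h_iff assms that by blast
  moreover have "g a \<noteq> {}"
    using submodule_zero[OF subfunctor_submodule[OF sub(1) assms]] by blast
  ultimately show "carrier (obj quot a) = {\<zero>\<^bsub>obj quot a\<^esub>}"
    unfolding quot_carrier quot_zero by auto
qed

text \<open>A linear map is injective once its kernel is trivial, and two cosets agree when the
  difference of representatives lies in \<open>h\<close>; so cosets can be eliminated.\<close>

lemma quot_iso_iff:
  assumes ab: "a \<in> points" "b \<in> points" "a \<preceq> b"
  shows "arr quot a b \<in> linear_isos R (obj quot a) (obj quot b) \<longleftrightarrow>
    (\<forall>x\<in>g a. arr f a b x \<in> h b \<longrightarrow> x \<in> h a) \<and>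
    (\<forall>y\<in>g b. \<exists>x\<in>g a. y \<ominus>\<^bsub>obj f b\<^esub> arr f a b x \<in> h b)"
proof -
  interpret linear_map R "obj f a" "obj f b" "arr f a b" using arr_linear_map ab by blast
  note arr_g = subfunctor_arr[OF sub(1) ab]
  have inj: "inj_on (arr quot a b) (carrier (obj quot a)) \<longleftrightarrow>
    (\<forall>x\<in>g a. arr f a b x \<in> h b \<longrightarrow> x \<in> h a)"
  proof
    assume inj: "inj_on (arr quot a b) (carrier (obj quot a))"
    show "\<forall>x\<in>g a. arr f a b x \<in> h b \<longrightarrow> x \<in> h a"
    proof (intro ballI impI)
      fix x assume x: "x \<in> g a" "arr f a b x \<in> h b"
      have zero: "\<zero>\<^bsub>obj f a\<^esub> \<in> g a"
        using submodule_zero[OF subfunctor_submodule[OF sub(1) ab(1)]] .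
      have "coset a \<zero>\<^bsub>obj f a\<^esub> = h a"
        using M.coset_zero[OF h_submodule[OF ab(1)]] .
      moreover have "coset b \<zero>\<^bsub>obj f b\<^esub> = h b"
        using N.coset_zero[OF h_submodule[OF ab(2)]] .
      moreover have "arr quot a b (coset a x) = h b"
        using x quot_arr[OF ab x(1)] coset_eq_h_iff[OF ab(2) arr_g[OF x(1)]] by simp
      ultimately have "arr quot a b (coset a x) = arr quot a b (coset a \<zero>\<^bsub>obj f a\<^esub>)"
        using quot_arr[OF ab zero] map_zero by simp
      then have "coset a x = coset a \<zero>\<^bsub>obj f a\<^esub>"
        using inj x(1) zero by (auto simp: quot_carrier dest: inj_onD)
      then show "x \<in> h a"
        using \<open>coset a \<zero>\<^bsub>obj f a\<^esub> = h a\<close> coset_eq_h_iff ab(1) x(1) by simp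
    qed
  next
    assume *: "\<forall>x\<in>g a. arr f a b x \<in> h b \<longrightarrow> x \<in> h a"
    show "inj_on (arr quot a b) (carrier (obj quot a))"
    proof (rule inj_onI)
      fix A B assume "A \<in> carrier (obj quot a)" "B \<in> carrier (obj quot a)"
        and eq: "arr quot a b A = arr quot a b B"
      then obtain x y where xy: "x \<in> g a" "A = coset a x" "y \<in> g a" "B = coset a y"
        by (auto simp: quot_carrier)
      then have "arr f a b x \<ominus>\<^bsub>obj f b\<^esub> arr f a b y \<in> h b"
        using eq quot_arr[OF ab] coset_eq_coset_iff[OF ab(2)] arr_g by simp
      then have "arr f a b (x \<ominus>\<^bsub>obj f a\<^esub> y) \<in> h b"
        using xy g_carrier[OF ab(1)] by (simp add: map_minus)
      then show "A = B"
        using * xy submodule_minus[OF subfunctor_submodule[OF sub(1) ab(1)]]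
          coset_eq_coset_iff[OF ab(1)] by simp
    qed
  qed
  have "arr quot a b ` carrier (obj quot a) = (\<lambda>x. coset b (arr f a b x)) ` g a"
    unfolding quot_carrier image_image using quot_arr[OF ab] by (rule image_cong[OF HOL.refl])
  moreover have "(\<lambda>x. coset b (arr f a b x)) ` g a \<subseteq> coset b ` g b"
    using arr_g by blast
  ultimately have "arr quot a b ` carrier (obj quot a) = carrier (obj quot b) \<longleftrightarrow>
    coset b ` g b \<subseteq> (\<lambda>x. coset b (arr f a b x)) ` g a"
    unfolding quot_carrier[of b] by auto
  also have "\<dots> \<longleftrightarrow> (\<forall>y\<in>g b. \<exists>x\<in>g a. coset b y = coset b (arr f a b x))"
    by (simp add: image_subset_iff image_iff)
  also have "\<dots> \<longleftrightarrow> (\<forall>y\<in>g b. \<exists>x\<in>g a. y \<ominus>\<^bsub>obj f b\<^esub> arr f a b x \<in> h b)"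
    using coset_eq_coset_iff[OF ab(2)] arr_g by blast
  finally show ?thesis
    using inj quot_arr_linear[OF ab] by (simp add: linear_isos_def bij_betw_def)
qed

lemma quot_interval_diagram_iff:
  assumes "J \<subseteq> points"
  shows "quot \<in> interval_diagrams side R I J \<longleftrightarrow>
    (\<forall>a\<in>points - J. g a \<subseteq> h a) \<and>
    (\<forall>a\<in>J. \<forall>b\<in>J. a \<preceq> b \<longrightarrow>
      (\<forall>x\<in>g a. arr f a b x \<in> h b \<longrightarrow> x \<in> h a) \<and>
      (\<forall>y\<in>g b. \<exists>x\<in>g a. y \<ominus>\<^bsub>obj f b\<^esub> arr f a b x \<in> h b))"
proof -
  have "(\<forall>a\<in>points - J. carrier (obj quot a) = {\<zero>\<^bsub>obj quot a\<^esub>}) \<longleftrightarrow> (\<forall>a\<in>points - J. g a \<subseteq> h a)"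
    by (intro ball_cong HOL.refl quot_zero_iff) simp
  moreover have "(\<forall>a\<in>J. \<forall>b\<in>J. a \<preceq> b \<longrightarrow> arr quot a b \<in> linear_isos R (obj quot a) (obj quot b)) \<longleftrightarrow>
    (\<forall>a\<in>J. \<forall>b\<in>J. a \<preceq> b \<longrightarrow>
      (\<forall>x\<in>g a. arr f a b x \<in> h b \<longrightarrow> x \<in> h a) \<and>
      (\<forall>y\<in>g b. \<exists>x\<in>g a. y \<ominus>\<^bsub>obj f b\<^esub> arr f a b x \<in> h b))"
    using assms by (intro ball_cong HOL.refl imp_cong quot_iso_iff) auto
  ultimately show ?thesis
    using quot_functor by (simp add: interval_diagrams_def)
qed

end

section \<open>The quotients of the constructed homomorphism\<close>

context module_diagram
begin

abbreviation "below \<equiv> down (interval_poset I)"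
abbreviation "strictly_below \<equiv> strict_down (interval_poset I)"

text \<open>A bar over \<open>a\<close> cannot be \<open>J\<close> when \<open>a\<close> is outside
  \<open>J\<close>, so removing \<open>J\<close> loses no bar there.\<close>

lemma interval_sum_strict_down:
  assumes "a \<in> points" "a \<notin> J"
  shows "interval_sum (below J) a \<subseteq> interval_sum (strictly_below J) a"
proof (rule interval_sum_mono[OF assms(1)])
  have "segment s T \<noteq> J" if "s \<preceq> a" "a \<in> T" for s T
    using that assms(2) by (auto simp: segment_def)
  then show "bars (below J) a \<subseteq> bars (strictly_below J) a"
    by (auto simp: bars_def strict_down_eq)
qed

text \<open>Among the bars over \<open>a\<close> below the segment, \<open>(s, T)\<close> is the
  largest in both coordinates, so its piece contains all others and the sum collapses to it.\<close>

lemma interval_sum_down: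
  assumes T: "T \<in> downsets" "s \<in> T" and a: "a \<in> segment s T"
  shows "interval_sum (below (segment s T)) a = born s a \<inter> dies T a"
proof
  have pts: "s \<in> points" "a \<in> points" "s \<preceq> a" "a \<in> T"
    using assms downset_points by (auto simp: segment_def)
  show "interval_sum (below (segment s T)) a \<subseteq> born s a \<inter> dies T a"
  proof (rule interval_sum_least[OF pts(2)])
    show "submodule (born s a \<inter> dies T a) R (obj f a)"
      using operator_group.Int_submodule[OF obj_operator_group[OF pts(2)] born_submodule dies_submodule] pts
      by blast
    show "generators (below (segment s T)) a \<subseteq> born s a \<inter> dies T a"
    proof
      fix x assume "x \<in> generators (below (segment s T)) a"
      then obtain s' T' where x: "(s', T') \<in> bars (below (segment s T)) a" "x \<in> born s' a" "x \<in> dies T' a"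
        by (rule generatorsE)
      then have "s' \<preceq> s \<and> T' \<subseteq> T" "s' \<in> points"
        using segment_in_down_iff[OF _ _ T] bars_points[OF x(1)] by (auto simp: bars_iff)
      then show "x \<in> born s a \<inter> dies T a"
        using x pts born_mono[of s' s a] dies_mono[of T' T a] by blast
    qed
  qed
  have "(s, T) \<in> bars (below (segment s T)) a"
    using pts T segment_in_down_iff[OF T T] refl by (simp add: bars_iff)
  then show "born s a \<inter> dies T a \<subseteq> interval_sum (below (segment s T)) a"
    using generatorsI generators_in_interval_sum[OF pts(2)] by blast
qed

text \<open>Surjectivity holds even before passing to the quotient, by lifting pieces. For
  injectivity, the strict part at \<open>b\<close> is covered by the strict part at
  \<open>a\<close>. An element mapped into it can therefore be corrected within the strict part to
  one mapped to zero, and such an element belongs to a bar that ends before \<open>b\<close>, thus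
  to a shorter bar than \<open>J\<close>.\<close>

lemma interval_sum_quotient:
  assumes J: "J \<in> intervals I"
  shows "quotient_diagram f (interval_sum (below J)) (interval_sum (strictly_below J))
    \<in> interval_diagrams side R I J"
proof -
  have "interval_sum (strictly_below J) a \<subseteq> interval_sum (below J) a" if "a \<in> points" for a
    by (rule interval_sum_mono[OF that]) (auto simp: bars_def strict_down_eq)
  then interpret nested_subfunctors I side R f "interval_sum (below J)" "interval_sum (strictly_below J)"
    by unfold_locales (simp_all add: interval_sum_subfunctor)
  obtain s T where T: "T \<in> downsets" "s \<in> T" and J_eq: "J = segment s T"
    using J by (rule interval_cases)
  have J_points: "J \<subseteq> points"
    using J by (auto simp: intervals_def)
  have pts: "s \<in> points" "a \<in> points" "s \<preceq> a" "a \<in> T" if "a \<in> J" for a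
    using that T downset_points J_eq by (auto simp: segment_def)
  have "(\<forall>x\<in>interval_sum (below J) a. arr f a b x \<in> interval_sum (strictly_below J) b \<longrightarrow>
        x \<in> interval_sum (strictly_below J) a) \<and>
      (\<forall>y\<in>interval_sum (below J) b. \<exists>x\<in>interval_sum (below J) a.
        y \<ominus>\<^bsub>obj f b\<^esub> arr f a b x \<in> interval_sum (strictly_below J) b)"
    if a: "a \<in> J" and b: "b \<in> J" and ab: "a \<preceq> b" for a b
  proof
    note a_pts = pts[OF a] and b_pts = pts[OF b]
    interpret linear_map R "obj f a" "obj f b" "arr f a b"
      using arr_linear_map a_pts(2) b_pts(2) ab by blast
    have down_a: "interval_sum (below J) a = born s a \<inter> dies T a"
      and down_b: "interval_sum (below J) b = born s b \<inter> dies T b"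
      using interval_sum_down[OF T] a b J_eq by simp_all
    \<comment> \<open>The image filtration provides a preimage born by \<open>r\<close>; because
      \<open>b\<close> is still in \<open>V\<close>, that preimage automatically dies within
      \<open>V\<close>.\<close>
    have lift: "\<exists>x\<in>born r a \<inter> dies V a. arr f a b x = y"
      if prems: "r \<in> points" "r \<preceq> a" "V \<in> downsets" "b \<in> V" "y \<in> born r b" "y \<in> dies V b" for r V y
    proof -
      obtain x where x: "x \<in> born r a" "y = arr f a b x"
        using arr_image_born[OF prems(1) a_pts(2) b_pts(2) prems(2) ab] prems(5) by blast
      then have "x \<in> dies V a"
        using dies_pullback[OF prems(3) a_pts(2) prems(4) ab] born_carrier[OF prems(1) a_pts(2) prems(2)] prems(6)
        by blast
      then show ?thesis using x by blast
    qed
    show "\<forall>y\<in>interval_sum (below J) b. \<exists>x\<in>interval_sum (below J) a.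
        y \<ominus>\<^bsub>obj f b\<^esub> arr f a b x \<in> interval_sum (strictly_below J) b"
    proof
      fix y assume y: "y \<in> interval_sum (below J) b"
      then obtain x where x: "x \<in> interval_sum (below J) a" "arr f a b x = y"
        using lift[of s T y] a_pts b_pts T down_a down_b by blast
      then have "y \<ominus>\<^bsub>obj f b\<^esub> arr f a b x = \<zero>\<^bsub>obj f b\<^esub>"
        using g_carrier[OF b_pts(2) y] by (simp add: a_minus_def N.r_neg)
      then show "\<exists>x\<in>interval_sum (below J) a.
          y \<ominus>\<^bsub>obj f b\<^esub> arr f a b x \<in> interval_sum (strictly_below J) b"
        using x(1) submodule_zero[OF h_submodule[OF b_pts(2)]] by metis
    qed
    have image: "interval_sum (strictly_below J) b \<subseteq> arr f a b ` interval_sum (strictly_below J) a"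
    proof (rule interval_sum_least[OF b_pts(2) image_submodule[OF h_submodule[OF a_pts(2)]]], rule subsetI)
      fix y assume "y \<in> generators (strictly_below J) b"
      then obtain r V where rV: "(r, V) \<in> bars (strictly_below J) b" "y \<in> born r b" "y \<in> dies V b"
        by (rule generatorsE)
      have r: "r \<in> points" "V \<in> downsets" "b \<in> V" "segment r V \<in> strictly_below J" "r \<in> V"
        using rV bars_points[OF rV(1)] by (auto simp: bars_iff)
      then have "r \<preceq> s"
        using segment_in_down_iff[OF r(2,5) T] J_eq by (auto simp: strict_down_eq)
      then have "r \<preceq> a" using trans[of r s a] r a_pts by blast
      moreover have "a \<in> V" using downset_closed r ab a_pts(2) by blast
      ultimately have "(r, V) \<in> bars (strictly_below J) a"
        using r by (simp add: bars_iff)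
      moreover obtain x where "x \<in> born r a \<inter> dies V a" "arr f a b x = y"
        using lift[OF r(1) \<open>r \<preceq> a\<close> r(2,3) rV(2,3)] by blast
      ultimately show "y \<in> arr f a b ` interval_sum (strictly_below J) a"
        using generatorsI generators_in_interval_sum[OF a_pts(2)] by blast
    qed
    show "\<forall>x\<in>interval_sum (below J) a. arr f a b x \<in> interval_sum (strictly_below J) b \<longrightarrow>
        x \<in> interval_sum (strictly_below J) a"
    proof (intro ballI impI)
      fix x assume x: "x \<in> interval_sum (below J) a"
        and fx: "arr f a b x \<in> interval_sum (strictly_below J) b"
      show "x \<in> interval_sum (strictly_below J) a"
      \<comment> \<open>For \<open>a = b\<close> the set \<open>V\<close> chosen below would not
        contain \<open>a\<close>.\<close>
      proof (cases "a = b")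
        case True
        then show ?thesis
          using fx arr_id[OF a_pts(2)] g_carrier[OF a_pts(2) x] by simp
      next
        case False
        obtain y where y: "y \<in> interval_sum (strictly_below J) a" "arr f a b y = arr f a b x"
          using image fx by force
        have carr: "x \<in> carrier (obj f a)" "y \<in> carrier (obj f a)"
          using g_carrier[OF a_pts(2)] x y(1) nested[OF a_pts(2)] by blast+
        \<comment> \<open>The part of the well-order before \<open>b\<close>: dying within
          \<open>V\<close> amounts to vanishing from \<open>b\<close> on. As \<open>b\<close> is in
          \<open>T\<close> but not in \<open>V\<close>, the bar \<open>(s, V)\<close> is strictly
          below \<open>J\<close>.\<close>
        define V where "V = {c \<in> points. \<not> b \<preceq> c}"
        have V: "V \<in> downsets"
          unfolding V_def using below_downset b_pts(2) .
        have "a \<in> V"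
          unfolding V_def using antisym[OF ab] False a_pts(2) b_pts(2) by blast
        have "V \<subseteq> T"
          unfolding V_def using downset_closed[OF T(1) b_pts(4)] total b_pts(2) by blast
        have "x \<ominus>\<^bsub>obj f a\<^esub> y \<in> dies V a"
        proof -
          have "arr f a b (x \<ominus>\<^bsub>obj f a\<^esub> y) = \<zero>\<^bsub>obj f b\<^esub>"
            using map_minus[OF carr] y(2) N.r_neg[OF map_closed[OF carr(1)]] by (simp only: a_minus_def)
          then have "arr f a c (x \<ominus>\<^bsub>obj f a\<^esub> y) = \<zero>\<^bsub>obj f c\<^esub>" if "c \<in> points - V" for c
          proof -
            have c: "c \<in> points" "b \<preceq> c" using that by (auto simp: V_def)
            interpret bc: linear_map R "obj f b" "obj f c" "arr f b c"
              using arr_linear_map c b_pts(2) by blast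
            show ?thesis
              using arr_comp[OF a_pts(2) b_pts(2) c(1) ab c(2), of "x \<ominus>\<^bsub>obj f a\<^esub> y"] carr
                \<open>arr f a b (x \<ominus>\<^bsub>obj f a\<^esub> y) = \<zero>\<^bsub>obj f b\<^esub>\<close> bc.map_zero by simp
          qed
          then show ?thesis
            using carr by (simp add: dies_def)
        qed
        moreover have "x \<ominus>\<^bsub>obj f a\<^esub> y \<in> born s a"
          using x y(1) nested[OF a_pts(2)] submodule_minus[OF born_submodule[OF a_pts(1-3)]]
          unfolding down_a by blast
        moreover have "(s, V) \<in> bars (strictly_below J) a"
        proof -
          have "s \<in> V" using downset_closed V \<open>a \<in> V\<close> a_pts by blast
          moreover have "V \<noteq> T" using b_pts(4) refl[OF b_pts(2)] by (auto simp: V_def)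
          ultimately show ?thesis
            using V \<open>a \<in> V\<close> a_pts \<open>V \<subseteq> T\<close> segment_in_down_iff[OF V _ T] segment_inject(2)[OF V _ T]
              refl J_eq by (auto simp: bars_iff strict_down_eq)
        qed
        ultimately have "x \<ominus>\<^bsub>obj f a\<^esub> y \<in> interval_sum (strictly_below J) a"
          using generatorsI generators_in_interval_sum[OF a_pts(2)] by blast
        then have "(x \<ominus>\<^bsub>obj f a\<^esub> y) \<oplus>\<^bsub>obj f a\<^esub> y \<in> interval_sum (strictly_below J) a"
          using submodule_add[OF h_submodule[OF a_pts(2)]] y(1) by blast
        moreover have "(x \<ominus>\<^bsub>obj f a\<^esub> y) \<oplus>\<^bsub>obj f a\<^esub> y = x"
          using carr by (simp add: a_minus_def M.a_assoc M.l_neg)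
        ultimately show ?thesis by simp
      qed
    qed
  qed
  then show ?thesis
    using quot_interval_diagram_iff[OF J_points] interval_sum_strict_down by blast
qed

end


section \<open>Uniqueness\<close>

context well_ordered
begin

text \<open>The lexicographic order is a linear extension of the order of intervals.\<close>

definition lex_le :: "'i \<Rightarrow> 'i set \<Rightarrow> 'i \<Rightarrow> 'i set \<Rightarrow> bool" where
  "lex_le r V s T \<longleftrightarrow> r \<preceq> s \<and> (r = s \<longrightarrow> V \<subseteq> T)"

definition lex_less :: "'i \<Rightarrow> 'i set \<Rightarrow> 'i \<Rightarrow> 'i set \<Rightarrow> bool" where
  "lex_less r V s T \<longleftrightarrow> r \<preceq> s \<and> (r = s \<longrightarrow> V \<subset> T)"

lemma lex_induct [consumes 2, case_names less]:
  assumes "T \<in> downsets" "s \<in> T"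
    and step: "\<And>s T. \<lbrakk>T \<in> downsets; s \<in> T;
      \<And>r V. \<lbrakk>V \<in> downsets; r \<in> V; lex_less r V s T\<rbrakk> \<Longrightarrow> P r V\<rbrakk> \<Longrightarrow> P s T"
  shows "P s T"
proof -
  have "T \<in> downsets \<longrightarrow> s \<in> T \<longrightarrow> P s T" for s T
  proof (induction "(s, T)" arbitrary: s T rule: wf_induct_rule[OF wf_lex_prod[OF wf_less wf_downsets]])
    case (1 s T)
    show ?case
    proof (intro impI)
      assume T: "T \<in> downsets" "s \<in> T"
      show "P s T"
      proof (rule step[OF T])
        fix r V assume "V \<in> downsets" "r \<in> V" "lex_less r V s T"
        then show "P r V"
          using 1[of r V] T downset_points by (auto simp: lex_less_def)
      qed
    qed
  qed
  then show ?thesis using assms by blast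
qed

definition started_by :: "'i \<Rightarrow> 'i set set" where
  "started_by s = {segment r V | r V. V \<in> downsets \<and> r \<in> V \<and> r \<preceq> s}"

definition ended_by :: "'i set \<Rightarrow> 'i set set" where
  "ended_by T = {segment r V | r V. V \<in> downsets \<and> r \<in> V \<and> V \<subseteq> T}"

lemma segment_started_by_iff:
  "\<lbrakk>V \<in> downsets; r \<in> V\<rbrakk> \<Longrightarrow> segment r V \<in> started_by s \<longleftrightarrow> r \<preceq> s"
  unfolding started_by_def using segment_inject[of V r] by blast

lemma segment_ended_by_iff:
  "\<lbrakk>V \<in> downsets; r \<in> V\<rbrakk> \<Longrightarrow> segment r V \<in> ended_by T \<longleftrightarrow> V \<subseteq> T"
  unfolding ended_by_def using segment_inject[of V r] by blast

lemma started_by_downset: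
  assumes s: "s \<in> points"
  shows "started_by s \<in> interval_downsets"
proof (rule interval_downsetI)
  show "started_by s \<subseteq> intervals I"
    unfolding started_by_def using segment_interval by blast
  fix r V r' V' assume "segment r' V' \<in> started_by s" "V' \<in> downsets" "r' \<in> V'"
    "V \<in> downsets" "r \<in> V" "r \<preceq> r'" "V \<subseteq> V'"
  then show "segment r V \<in> started_by s"
    using trans[of r r' s] downset_points s by (simp add: segment_started_by_iff)
qed

lemma ended_by_downset: "ended_by T \<in> interval_downsets"
proof (rule interval_downsetI)
  show "ended_by T \<subseteq> intervals I"
    unfolding ended_by_def using segment_interval by blast
qed (auto simp: segment_ended_by_iff)

lemma below_eq:
  assumes T: "T \<in> downsets" "s \<in> T"
  shows "down (interval_poset I) (segment s T) = started_by s \<inter> ended_by T"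
proof (intro equalityI subsetI)
  fix J assume J: "J \<in> down (interval_poset I) (segment s T)"
  then have "J \<in> intervals I" by (simp add: down_def interval_poset_def)
  then obtain r V where V: "V \<in> downsets" "r \<in> V" "J = segment r V"
    by (rule interval_cases)
  then show "J \<in> started_by s \<inter> ended_by T"
    using J T by (simp add: segment_in_down_iff segment_started_by_iff segment_ended_by_iff)
next
  fix J assume J: "J \<in> started_by s \<inter> ended_by T"
  then obtain r V where V: "V \<in> downsets" "r \<in> V" "J = segment r V"
    by (auto simp: started_by_def)
  then show "J \<in> down (interval_poset I) (segment s T)"
    using J T by (simp add: segment_in_down_iff segment_started_by_iff segment_ended_by_iff)
qed

text \<open>An initial stretch of the lexicographic order with \<open>ended_by T\<close> adjoined.
  These stretches form a chain of down-sets above \<open>ended_by T\<close>, and every interval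
  occurs in one of them; an element that dies within \<open>T\<close> is brought down along this
  chain.\<close>

definition up_to :: "'i set \<Rightarrow> 'i \<Rightarrow> 'i set \<Rightarrow> 'i set set" where
  "up_to T s V = ended_by T \<union> {segment r W | r W. W \<in> downsets \<and> r \<in> W \<and> lex_le r W s V}"

lemma lex_le_trans:
  assumes "lex_le q U r V" "lex_le r V s W" and pts: "q \<in> points" "r \<in> points" "s \<in> points"
  shows "lex_le q U s W"
proof -
  have "q \<preceq> s" using assms trans[of q r s] by (simp add: lex_le_def)
  moreover have "U \<subseteq> W" if "q = s"
  proof -
    have "q = r" "r = s" using assms that antisym[of q r] by (auto simp: lex_le_def)
    then show ?thesis using assms by (simp add: lex_le_def) blast
  qed
  ultimately show ?thesis by (simp add: lex_le_def)
qed

lemma lex_le_total: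
  assumes "V \<in> downsets" "r \<in> V" "W \<in> downsets" "s \<in> W"
  shows "lex_le r V s W \<or> lex_le s W r V"
proof -
  have "r \<preceq> s \<or> s \<preceq> r" "V \<subseteq> W \<or> W \<subseteq> V"
    using assms downset_points total downsets_chain by blast+
  then show ?thesis using antisym assms downset_points by (auto simp: lex_le_def)
qed

lemma lex_less_imp_le: "lex_less r V s W \<Longrightarrow> lex_le r V s W"
  by (auto simp: lex_less_def lex_le_def)

lemma up_to_mono:
  assumes "lex_le r V s W" "V \<in> downsets" "r \<in> V" "W \<in> downsets" "s \<in> W"
  shows "up_to T r V \<subseteq> up_to T s W"
proof -
  have "lex_le q U s W" if "U \<in> downsets" "q \<in> U" "lex_le q U r V" for q U
    using lex_le_trans[OF that(3) assms(1)] that assms downset_points by blast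
  then show ?thesis unfolding up_to_def by blast
qed

lemma up_to_self:
  assumes "V \<in> downsets" "s \<in> V"
  shows "segment s V \<in> up_to T s V"
proof -
  have "lex_le s V s V"
    using assms refl downset_points by (simp add: lex_le_def)
  then show ?thesis
    using assms unfolding up_to_def by blast
qed

lemma up_to_downset:
  assumes V: "V \<in> downsets" "s \<in> V"
  shows "up_to T s V \<in> interval_downsets"
proof -
  have "{segment r W | r W. W \<in> downsets \<and> r \<in> W \<and> lex_le r W s V} \<in> interval_downsets"
    (is "?L \<in> _")
  proof (rule interval_downsetI)
    show "?L \<subseteq> intervals I" using segment_interval by blast
    fix r W r' W' assume *: "segment r' W' \<in> ?L" "W' \<in> downsets" "r' \<in> W'"
      "W \<in> downsets" "r \<in> W" "r \<preceq> r'" "W \<subseteq> W'"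
    then have "lex_le r' W' s V"
      using segment_inject by blast
    moreover have "lex_le r W r' W'"
      using * by (simp add: lex_le_def)
    moreover have "r \<in> points" "r' \<in> points" "s \<in> points"
      using * V downset_points by blast+
    ultimately have "lex_le r W s V"
      using lex_le_trans by blast
    then show "segment r W \<in> ?L" using * by blast
  qed
  then show ?thesis
    unfolding up_to_def by (intro downset_lattice_Un ended_by_downset)
qed

end

section \<open>The values of an arbitrary homomorphism satisfying the quotient condition\<close>

locale interval_filtration = module_diagram +
  fixes \<Omega>
  assumes hom: "\<Omega> \<in> complete_lattice_hom (downset_lattice (interval_poset I)) (Sub R I f)"
    and quotients: "\<And>J. J \<in> intervals I \<Longrightarrow>
      quotient_diagram f (\<Omega> (below J)) (\<Omega> (strictly_below J)) \<in> interval_diagrams side R I J"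
begin

lemma hom_subfunctor: "D \<in> interval_downsets \<Longrightarrow> \<Omega> D \<in> subfunctors"
  using hom by (auto simp: complete_lattice_hom_def)

lemma hom_image: "A \<subseteq> interval_downsets \<Longrightarrow> \<Omega> ` A \<subseteq> subfunctors"
  using hom_subfunctor by blast

lemmas hom_submodule = subfunctor_submodule[OF hom_subfunctor]
lemmas hom_carrier = subfunctor_carrier[OF hom_subfunctor]
lemmas hom_arr = subfunctor_arr[OF hom_subfunctor]

lemma hom_Union:
  assumes A: "A \<subseteq> interval_downsets" and a: "a \<in> points"
  shows "\<Omega> (\<Union>A) a = span a (\<Union>D\<in>A. \<Omega> D a)"
proof -
  have "\<Omega> (\<Squnion>\<^bsub>downset_lattice (interval_poset I)\<^esub> A) = \<Squnion>\<^bsub>Sub R I f\<^esub> (\<Omega> ` A)"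
    using hom A by (simp add: complete_lattice_hom_def sup_pres_def)
  then show ?thesis
    using a by (simp add: downset_lattice_sup[OF A] Sub_sup[OF hom_image[OF A]] join_subfunctor_def)
qed

lemma hom_meet:
  assumes A: "A \<subseteq> interval_downsets" and a: "a \<in> points"
  shows "\<Omega> (intervals I \<inter> \<Inter>A) a = carrier (obj f a) \<inter> (\<Inter>D\<in>A. \<Omega> D a)"
proof -
  have "\<Omega> (\<Sqinter>\<^bsub>downset_lattice (interval_poset I)\<^esub> A) = \<Sqinter>\<^bsub>Sub R I f\<^esub> (\<Omega> ` A)"
    using hom A by (simp add: complete_lattice_hom_def inf_pres_def)
  then show ?thesis
    using a downset_lattice_inf[OF A]
    by (simp add: Sub_inf[OF hom_image[OF A]] meet_subfunctor_def interval_poset_def)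
qed

lemma hom_all: "a \<in> points \<Longrightarrow> \<Omega> (intervals I) a = carrier (obj f a)"
  using hom_meet[of "{}" a] by simp

lemma hom_empty: "a \<in> points \<Longrightarrow> \<Omega> {} a = {\<zero>\<^bsub>obj f a\<^esub>}"
proof -
  assume a: "a \<in> points"
  have "span a {} \<subseteq> {\<zero>\<^bsub>obj f a\<^esub>}"
    using operator_group.zero_submodule[OF obj_operator_group[OF a]] by (intro submodule_span_least) auto
  then show ?thesis
    using hom_Union[of "{}" a] a submodule_zero[OF hom_submodule[OF downset_lattice_empty a]] by auto
qed

lemma hom_Int:
  assumes D: "D \<in> interval_downsets" "D' \<in> interval_downsets" and a: "a \<in> points"
  shows "\<Omega> (D \<inter> D') a = \<Omega> D a \<inter> \<Omega> D' a"
proof -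
  have "intervals I \<inter> \<Inter>{D, D'} = D \<inter> D'"
    using D interval_downset_intervals by blast
  moreover have "carrier (obj f a) \<inter> (\<Inter>D\<in>{D, D'}. \<Omega> D a) = \<Omega> D a \<inter> \<Omega> D' a"
    using hom_carrier[OF D(1) a] by blast
  ultimately show ?thesis
    using hom_meet[of "{D, D'}" a] a D by simp
qed

lemma hom_mono:
  assumes "D \<in> interval_downsets" "D' \<in> interval_downsets" "a \<in> points" "D \<subseteq> D'"
  shows "\<Omega> D a \<subseteq> \<Omega> D' a"
  using hom_Int[OF assms(1,2,3)] assms(4) by (metis inf.orderE inf_le2)

text \<open>A down-set is the union of the principal down-sets of its members, and this join is
  preserved.\<close>

lemma hom_least:
  assumes D: "D \<in> interval_downsets" and a: "a \<in> points" and N: "submodule N R (obj f a)"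
    and le: "\<And>J. J \<in> D \<Longrightarrow> \<Omega> (below J) a \<subseteq> N"
  shows "\<Omega> D a \<subseteq> N"
proof -
  have J: "J \<in> intervals I" if "J \<in> D" for J
    using interval_downset_intervals[OF D that] .
  have "below J \<subseteq> D" if "J \<in> D" for J
    using downset_latticeD[OF D that] by (auto simp: down_def)
  then have "\<Union>(below ` D) = D"
    using J down_self by blast
  moreover have "below ` D \<subseteq> interval_downsets"
    using J down_interval_downset by blast
  ultimately have "\<Omega> D a = span a (\<Union>J\<in>D. \<Omega> (below J) a)"
    using hom_Union[of "below ` D" a] a by simp
  moreover have "(\<Union>J\<in>D. \<Omega> (below J) a) \<subseteq> N"
    using le by blast
  ultimately show ?thesis
    using submodule_span_least[OF N] by simp
qed

lemma
  assumes J: "J \<in> intervals I"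
  shows quotient_outside: "\<lbrakk>a \<in> points; a \<notin> J\<rbrakk> \<Longrightarrow> \<Omega> (below J) a \<subseteq> \<Omega> (strictly_below J) a"
    and quotient_inj: "\<lbrakk>a \<in> J; b \<in> J; a \<preceq> b; x \<in> \<Omega> (below J) a;
      arr f a b x \<in> \<Omega> (strictly_below J) b\<rbrakk> \<Longrightarrow> x \<in> \<Omega> (strictly_below J) a"
    and quotient_surj: "\<lbrakk>a \<in> J; b \<in> J; a \<preceq> b; y \<in> \<Omega> (below J) b\<rbrakk> \<Longrightarrow>
      \<exists>x\<in>\<Omega> (below J) a. y \<ominus>\<^bsub>obj f b\<^esub> arr f a b x \<in> \<Omega> (strictly_below J) b"
proof -
  note dn = down_interval_downset[OF J] strict_down_interval_downset[OF J]
  interpret nested_subfunctors I side R f "\<Omega> (below J)" "\<Omega> (strictly_below J)"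
  proof
    show "\<Omega> (strictly_below J) a \<subseteq> \<Omega> (below J) a" if "a \<in> points" for a
      using hom_mono[OF dn(2,1) that] by (auto simp: strict_down_eq)
  qed (use hom_subfunctor dn in blast)+
  have "J \<subseteq> points" using J by (auto simp: intervals_def)
  note * = quotients[OF J, unfolded quot_interval_diagram_iff[OF this]]
  show "\<lbrakk>a \<in> points; a \<notin> J\<rbrakk> \<Longrightarrow> \<Omega> (below J) a \<subseteq> \<Omega> (strictly_below J) a"
    "\<lbrakk>a \<in> J; b \<in> J; a \<preceq> b; x \<in> \<Omega> (below J) a; arr f a b x \<in> \<Omega> (strictly_below J) b\<rbrakk> \<Longrightarrow>
      x \<in> \<Omega> (strictly_below J) a"
    "\<lbrakk>a \<in> J; b \<in> J; a \<preceq> b; y \<in> \<Omega> (below J) b\<rbrakk> \<Longrightarrow>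
      \<exists>x\<in>\<Omega> (below J) a. y \<ominus>\<^bsub>obj f b\<^esub> arr f a b x \<in> \<Omega> (strictly_below J) b"
    using * by blast+
qed

text \<open>Allows a bound to be checked while adding one interval at a time to what lies strictly
  below it. The recursion is lexicographic: whatever is strictly below an interval of
  \<open>D\<close> is lexicographically smaller and still in \<open>D\<close>.\<close>

lemma hom_induct:
  assumes D: "D \<in> interval_downsets" and a: "a \<in> points" and N: "submodule N R (obj f a)"
    and step: "\<And>J. \<lbrakk>J \<in> D; \<Omega> (strictly_below J) a \<subseteq> N\<rbrakk> \<Longrightarrow> \<Omega> (below J) a \<subseteq> N"
  shows "\<Omega> D a \<subseteq> N"
proof (rule hom_least[OF D a N])
  have "segment s T \<in> D \<longrightarrow> \<Omega> (below (segment s T)) a \<subseteq> N" if "T \<in> downsets" "s \<in> T" for s T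
    using that
  proof (induction s T rule: lex_induct)
    case (less s T)
    show ?case
    proof
      assume J: "segment s T \<in> D"
      have "\<Omega> (strictly_below (segment s T)) a \<subseteq> N"
      proof (rule hom_least[OF strict_down_interval_downset a N])
        show "segment s T \<in> intervals I" using segment_interval less.hyps .
        fix L assume L: "L \<in> strictly_below (segment s T)"
        then have "L \<in> intervals I" by (simp add: strict_down_def interval_poset_def)
        then obtain r V where V: "V \<in> downsets" "r \<in> V" "L = segment r V"
          by (rule interval_cases)
        have le: "r \<preceq> s" "V \<subseteq> T" "\<not> (r = s \<and> V = T)"
          using L V segment_in_down_iff[OF V(1,2) less.hyps] by (auto simp: strict_down_eq)
        then have "lex_less r V s T" by (auto simp: lex_less_def)
        moreover have "segment r V \<in> D"
          using interval_downset_closed[OF D J less.hyps V(1,2)] le by blast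
        ultimately show "\<Omega> (below L) a \<subseteq> N"
          using less.IH V by blast
      qed
      then show "\<Omega> (below (segment s T)) a \<subseteq> N" using step J by blast
    qed
  qed
  then show "\<Omega> (below J) a \<subseteq> N" if "J \<in> D" for J
    using that interval_downset_intervals[OF D that] interval_cases by metis
qed

text \<open>The quotient for \<open>J\<close> vanishes at points outside \<open>J\<close>, so at
  \<open>a\<close> only intervals through \<open>a\<close> contribute.\<close>

lemma hom_outside:
  assumes D: "D \<in> interval_downsets" "D' \<in> interval_downsets" and a: "a \<in> points"
    and out: "\<And>J. \<lbrakk>J \<in> D'; J \<notin> D\<rbrakk> \<Longrightarrow> a \<notin> J"
  shows "\<Omega> D' a \<subseteq> \<Omega> D a"
proof (rule hom_induct[OF D(2) a hom_submodule[OF D(1) a]])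
  fix J assume J: "J \<in> D'" "\<Omega> (strictly_below J) a \<subseteq> \<Omega> D a"
  have J': "J \<in> intervals I" using interval_downset_intervals[OF D(2) J(1)] .
  show "\<Omega> (below J) a \<subseteq> \<Omega> D a"
  proof (cases "J \<in> D")
    case True
    then have "below J \<subseteq> D"
      using downset_latticeD[OF D(1)] by (auto simp: down_def)
    then show ?thesis using hom_mono[OF down_interval_downset[OF J'] D(1) a] by blast
  next
    case False
    then show ?thesis using quotient_outside[OF J' a] out J by blast
  qed
qed

text \<open>The limit step of the descent: the join over a chain is a plain union, so an element
  lies in one of its stages.\<close>

lemma hom_chain:
  assumes \<C>: "\<C> \<subseteq> interval_downsets" "\<C> \<noteq> {}"
    and chain: "\<And>D D'. \<lbrakk>D \<in> \<C>; D' \<in> \<C>\<rbrakk> \<Longrightarrow> D \<subseteq> D' \<or> D' \<subseteq> D"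
    and a: "a \<in> points" and x: "x \<in> \<Omega> (\<Union>\<C>) a"
  shows "\<exists>D\<in>\<C>. x \<in> \<Omega> D a"
proof -
  have "submodule (\<Union>((\<lambda>D. \<Omega> D a) ` \<C>)) R (obj f a)"
  proof (rule submodule_chain_Union)
    fix N N' assume N: "N \<in> (\<lambda>D. \<Omega> D a) ` \<C>"
    then show "submodule N R (obj f a)"
      using hom_submodule[OF _ a] \<C>(1) by blast
    assume "N' \<in> (\<lambda>D. \<Omega> D a) ` \<C>"
    then obtain D D' where "D \<in> \<C>" "D' \<in> \<C>" "N = \<Omega> D a" "N' = \<Omega> D' a"
      using N by blast
    moreover have "D \<in> interval_downsets" "D' \<in> interval_downsets"
      using \<C>(1) calculation by blast+
    ultimately show "N \<subseteq> N' \<or> N' \<subseteq> N"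
      using chain[of D D'] hom_mono[of D D' a] hom_mono[of D' D a] a by blast
  qed (use \<C> in simp)
  then have "span a (\<Union>D\<in>\<C>. \<Omega> D a) \<subseteq> (\<Union>D\<in>\<C>. \<Omega> D a)"
    by (rule submodule_span_least) blast
  then show ?thesis
    using x hom_Union[OF \<C>(1) a] by blast
qed

lemma hom_Un:
  assumes D: "D \<in> interval_downsets" "D' \<in> interval_downsets" and a: "a \<in> points"
    and x: "x \<in> \<Omega> (D \<union> D') a"
  obtains y z where "x = y \<oplus>\<^bsub>obj f a\<^esub> z" "y \<in> \<Omega> D a" "z \<in> \<Omega> D' a"
proof -
  interpret operator_group R "obj f a" using obj_operator_group[OF a] .
  let ?S = "{y \<oplus>\<^bsub>obj f a\<^esub> z | y z. y \<in> \<Omega> D a \<and> z \<in> \<Omega> D' a}"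
  note sub = hom_submodule[OF D(1) a] hom_submodule[OF D(2) a]
  have "\<Omega> D a \<union> \<Omega> D' a \<subseteq> ?S"
  proof
    fix w assume "w \<in> \<Omega> D a \<union> \<Omega> D' a"
    then show "w \<in> ?S"
    proof
      assume w: "w \<in> \<Omega> D a"
      then have "w = w \<oplus>\<^bsub>obj f a\<^esub> \<zero>\<^bsub>obj f a\<^esub>"
        using hom_carrier[OF D(1) a] by simp
      then show "w \<in> ?S" using w submodule_zero[OF sub(2)] by blast
    next
      assume w: "w \<in> \<Omega> D' a"
      then have "w = \<zero>\<^bsub>obj f a\<^esub> \<oplus>\<^bsub>obj f a\<^esub> w"
        using hom_carrier[OF D(2) a] by simp
      then show "w \<in> ?S" using w submodule_zero[OF sub(1)] by blast
    qed
  qed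
  then have "span a (\<Omega> D a \<union> \<Omega> D' a) \<subseteq> ?S"
    by (rule submodule_span_least[OF sum_submodule[OF sub]])
  moreover have "\<Omega> (D \<union> D') a = span a (\<Omega> D a \<union> \<Omega> D' a)"
    using hom_Union[of "{D, D'}" a] D a by simp
  ultimately show thesis using x that by blast
qed

text \<open>At \<open>s\<close> itself the value is everything, and transport along the arrow to
  \<open>a\<close> gives one inclusion. For the other, surjectivity of the quotient map from
  \<open>s\<close> to \<open>a\<close> writes each new element as something coming from
  \<open>s\<close> plus something from strictly lower intervals.\<close>

lemma hom_started_by:
  assumes s: "s \<in> points" and a: "a \<in> points" and sa: "s \<preceq> a"
  shows "\<Omega> (started_by s) a = born s a"
proof
  note dn = started_by_downset[OF s]
  have "carrier (obj f s) \<subseteq> \<Omega> (started_by s) s"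
  proof -
    \<comment> \<open>Every interval through \<open>s\<close> starts by \<open>s\<close>; the
      remaining ones contribute nothing at \<open>s\<close>.\<close>
    have "\<Omega> (intervals I) s \<subseteq> \<Omega> (started_by s) s"
    proof (rule hom_outside[OF dn _ s])
      show "intervals I \<in> interval_downsets"
        using downset_lattice_carrier[of "interval_poset I"] by (simp add: interval_poset_def)
      fix J assume "J \<in> intervals I" "J \<notin> started_by s"
      moreover obtain r V where "V \<in> downsets" "r \<in> V" "J = segment r V"
        using calculation(1) by (rule interval_cases)
      ultimately show "s \<notin> J"
        using segment_started_by_iff by (auto simp: segment_def)
    qed
    then show ?thesis using hom_all[OF s] by simp
  qed
  then show "born s a \<subseteq> \<Omega> (started_by s) a"
    unfolding born_def using hom_arr[OF dn s a sa] by blast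
  show "\<Omega> (started_by s) a \<subseteq> born s a"
  proof (rule hom_induct[OF dn a born_submodule[OF s a sa]])
    fix J assume J: "J \<in> started_by s" and IH: "\<Omega> (strictly_below J) a \<subseteq> born s a"
    have J': "J \<in> intervals I" using interval_downset_intervals[OF dn J] .
    obtain r V where V: "V \<in> downsets" "r \<in> V" "r \<preceq> s" "J = segment r V"
      using J by (auto simp: started_by_def)
    show "\<Omega> (below J) a \<subseteq> born s a"
    proof (cases "a \<in> J")
      case False
      then show ?thesis using quotient_outside[OF J' a] IH by blast
    next
      case True
      \<comment> \<open>\<open>J\<close> starts by \<open>s\<close> and contains \<open>a\<close>,
        so convexity puts \<open>s\<close> between; only then is the map from \<open>s\<close> to
        \<open>a\<close> one of the isomorphisms.\<close>
      then have "s \<in> J"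
        using V s sa downset_closed[OF V(1)] by (auto simp: segment_def)
      interpret linear_map R "obj f s" "obj f a" "arr f s a" using arr_linear_map s a sa .
      show ?thesis
      proof
        fix y assume y: "y \<in> \<Omega> (below J) a"
        then obtain x where x: "x \<in> \<Omega> (below J) s"
          "y \<ominus>\<^bsub>obj f a\<^esub> arr f s a x \<in> \<Omega> (strictly_below J) a"
          using quotient_surj[OF J' \<open>s \<in> J\<close> True sa] by blast
        note dn' = down_interval_downset[OF J']
        have "x \<in> carrier (obj f s)" using hom_carrier[OF dn' s x(1)] .
        then have "arr f s a x \<in> born s a" by (simp add: born_def)
        then have "(y \<ominus>\<^bsub>obj f a\<^esub> arr f s a x) \<oplus>\<^bsub>obj f a\<^esub> arr f s a x \<in> born s a"
          using submodule_add[OF born_submodule[OF s a sa]] x(2) IH by blast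
        moreover have "(y \<ominus>\<^bsub>obj f a\<^esub> arr f s a x) \<oplus>\<^bsub>obj f a\<^esub> arr f s a x = y"
          using hom_carrier[OF dn' a y] map_closed \<open>x \<in> carrier (obj f s)\<close>
          by (simp add: a_minus_def N.a_assoc N.l_neg)
        ultimately show "y \<in> born s a" by simp
      qed
    qed
  qed
qed

text \<open>
  An element that \<open>T\<close> kills already lies in \<open>\<Omega> (ended_by T)\<close>: remove the remaining intervals
  one by one, the lexicographically largest first. Each of them that contains \<open>a\<close> reaches beyond
  \<open>T\<close>, where the element vanishes, so injectivity of the interval quotient applies.
\<close>

lemma hom_ended_by:
  assumes T: "T \<in> downsets" and a: "a \<in> points"
  shows "\<Omega> (ended_by T) a = dies T a"
proof
  note dn = ended_by_downset[of T]
  show "\<Omega> (ended_by T) a \<subseteq> dies T a"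
  proof
    fix x assume x: "x \<in> \<Omega> (ended_by T) a"
    have "arr f a c x = \<zero>\<^bsub>obj f c\<^esub>" if c: "c \<in> points" "c \<notin> T" "a \<preceq> c" for c
    proof -
      \<comment> \<open>No interval ended by \<open>T\<close> passes through \<open>c\<close>, so
        the value at \<open>c\<close> is that of the empty join, namely zero.\<close>
      have "c \<notin> J" if "J \<in> ended_by T" for J
        using that c by (auto simp: ended_by_def segment_def)
      then have "\<Omega> (ended_by T) c \<subseteq> \<Omega> {} c"
        using hom_outside[OF downset_lattice_empty dn c(1)] by blast
      then show ?thesis
        using hom_arr[OF dn a c(1,3) x] hom_empty[OF c(1)] by auto
    qed
    then show "x \<in> dies T a" using hom_carrier[OF dn a x] by (auto simp: dies_def)
  qed
  \<comment> \<open>By totality of the lexicographic order the stretches form a chain, so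
    \<open>hom_chain\<close> finds a single stage. \<open>ended_by T\<close> is a member in its own
    right, which covers an empty \<open>P\<close>.\<close>
  have reduce: "x \<in> \<Omega> (ended_by T) a \<or> (\<exists>(s, V)\<in>P. x \<in> \<Omega> (up_to T s V) a)"
    if P: "\<And>s V. (s, V) \<in> P \<Longrightarrow> V \<in> downsets \<and> s \<in> V"
      and x: "x \<in> \<Omega> (ended_by T \<union> (\<Union>(s, V)\<in>P. up_to T s V)) a" for P x
  proof -
    define \<C> where "\<C> = insert (ended_by T) ((\<lambda>(s, V). up_to T s V) ` P)"
    have "\<C> \<subseteq> interval_downsets"
      using P dn up_to_downset by (auto simp: \<C>_def)
    moreover have "D \<subseteq> D' \<or> D' \<subseteq> D" if D: "D \<in> \<C>" "D' \<in> \<C>" for D D'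
    proof -
      have ended: "ended_by T \<subseteq> E" if "E \<in> \<C>" for E
        using that by (auto simp: \<C>_def up_to_def)
      consider "D = ended_by T" | "D' = ended_by T"
        | s V s' V' where "(s, V) \<in> P" "(s', V') \<in> P" "D = up_to T s V" "D' = up_to T s' V'"
        using D by (auto simp: \<C>_def)
      then show ?thesis
      proof cases
        case 3
        then show ?thesis
          using P lex_le_total[of V s V' s'] up_to_mono[of s V s' V' T] up_to_mono[of s' V' s V T]
          by blast
      qed (use ended D in blast)+
    qed
    moreover have "x \<in> \<Omega> (\<Union>\<C>) a"
      using x by (simp add: \<C>_def case_prod_unfold)
    ultimately have "\<exists>D\<in>\<C>. x \<in> \<Omega> D a"
      using hom_chain[of \<C> a x] a by (auto simp: \<C>_def)
    then show ?thesis by (auto simp: \<C>_def)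
  qed
  have up_to: "x \<in> dies T a \<longrightarrow> x \<in> \<Omega> (up_to T s V) a \<longrightarrow> x \<in> \<Omega> (ended_by T) a"
    if "V \<in> downsets" "s \<in> V" for s V x
    using that
  proof (induction s V rule: lex_induct)
    case (less s V)
    define J where "J = segment s V"
    \<comment> \<open>As written, \<open>lex_le\<close> also admits the pair \<open>(s, V)\<close>
      itself, whereas \<open>G_iff\<close>, stated with \<open>lex_less\<close>, and the later
      appeal to \<open>less.IH\<close> call for strictly earlier pairs.\<close>
    define P where "P = {(r, W). W \<in> downsets \<and> r \<in> W \<and> lex_less r W s V}"
    define G where "G = ended_by T \<union> (\<Union>(r, W)\<in>P. up_to T r W)"
    have J: "J \<in> intervals I" using segment_interval less.hyps by (simp add: J_def)
    note J_dn = down_interval_downset[OF J] strict_down_interval_downset[OF J]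
    have P: "W \<in> downsets \<and> r \<in> W" if "(r, W) \<in> P" for r W
      using that by (simp add: P_def)
    have G_dn: "G \<in> interval_downsets"
    proof -
      have "\<Union>(insert (ended_by T) ((\<lambda>(r, W). up_to T r W) ` P)) \<in> interval_downsets"
        using dn up_to_downset P by (intro downset_lattice_Union) auto
      then show ?thesis by (simp add: G_def case_prod_unfold)
    qed
    have G_iff: "segment r W \<in> G \<longleftrightarrow> segment r W \<in> ended_by T \<or> lex_less r W s V"
      if W: "W \<in> downsets" "r \<in> W" for r W
    proof
      assume "segment r W \<in> G"
      then consider "segment r W \<in> ended_by T"
        | q U q' U' where "U \<in> downsets" "q \<in> U" "lex_less q U s V" "segment r W = segment q' U'"
          "U' \<in> downsets" "q' \<in> U'" "lex_le q' U' q U"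
        by (auto simp: G_def P_def up_to_def)
      then show "segment r W \<in> ended_by T \<or> lex_less r W s V"
      proof cases
        case 2
        then have "r = q'" "W = U'" using segment_inject W by blast+
        then have le: "lex_le r W q U" using 2 by simp
        have pts: "r \<in> points" "q \<in> points" "s \<in> points"
          using W 2 less.hyps downset_points by blast+
        have "lex_le r W s V"
          using lex_le_trans[OF le lex_less_imp_le[OF 2(3)]] pts by blast
        moreover have "\<not> (r = s \<and> W = V)"
        proof
          assume eq: "r = s \<and> W = V"
          then have "q = s"
            using le 2(3) antisym[of s q] pts by (auto simp: lex_le_def lex_less_def)
          then show False
            using eq le 2(3) by (auto simp: lex_le_def lex_less_def)
        qed
        ultimately show ?thesis by (auto simp: lex_le_def lex_less_def)
      qed blast
    next
      assume "segment r W \<in> ended_by T \<or> lex_less r W s V"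
      then show "segment r W \<in> G"
      proof
        assume "lex_less r W s V"
        moreover have "segment r W \<in> up_to T r W"
          using up_to_self W .
        ultimately show ?thesis using W by (auto simp: G_def P_def)
      qed (simp add: G_def)
    qed
    have "up_to T s V = G \<union> below J"
    proof (intro equalityI subsetI)
      fix L assume "L \<in> up_to T s V"
      then consider "L \<in> ended_by T"
        | r W where "W \<in> downsets" "r \<in> W" "L = segment r W" "lex_le r W s V"
        by (auto simp: up_to_def)
      then show "L \<in> G \<union> below J"
      proof cases
        case 2
        then show ?thesis
          using G_iff[OF 2(1,2)] down_self[OF J]
          by (cases "r = s \<and> W = V") (auto simp: J_def lex_le_def lex_less_def)
      qed (simp add: G_def)
    next
      fix L assume L: "L \<in> G \<union> below J"
      then have "L \<in> intervals I"
        using interval_downset_intervals[OF downset_lattice_Un[OF G_dn J_dn(1)]] by blast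
      then obtain r W where W: "W \<in> downsets" "r \<in> W" "L = segment r W"
        by (rule interval_cases)
      then have "L \<in> ended_by T \<or> lex_le r W s V"
        using L G_iff[OF W(1,2)] segment_in_down_iff[OF W(1,2) less.hyps]
        by (auto simp: J_def lex_le_def lex_less_def)
      then show "L \<in> up_to T s V" using W by (auto simp: up_to_def)
    qed
    have strictly_below_G: "strictly_below J \<subseteq> G"
    proof
      fix L assume L: "L \<in> strictly_below J"
      then have "L \<in> intervals I"
        using interval_downset_intervals[OF J_dn(2)] by blast
      then obtain r W where W: "W \<in> downsets" "r \<in> W" "L = segment r W"
        by (rule interval_cases)
      have "lex_less r W s V"
        using L W segment_in_down_iff[OF W(1,2) less.hyps]
        by (auto simp: J_def strict_down_eq lex_less_def)
      then show "L \<in> G" using G_iff[OF W(1,2)] W(3) by simp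
    qed
    show ?case
    proof (intro impI)
      assume xT: "x \<in> dies T a" and "x \<in> \<Omega> (up_to T s V) a"
      then have "x \<in> \<Omega> (G \<union> below J) a"
        using \<open>up_to T s V = G \<union> below J\<close> by simp
      then obtain e y where eyx: "x = e \<oplus>\<^bsub>obj f a\<^esub> y" and e: "e \<in> \<Omega> G a" and y: "y \<in> \<Omega> (below J) a"
        using hom_Un[OF G_dn J_dn(1) a] by blast
      have carr: "e \<in> carrier (obj f a)" "y \<in> carrier (obj f a)"
        using hom_carrier[OF G_dn a e] hom_carrier[OF J_dn(1) a y] .
      have "x \<in> \<Omega> G a"
      \<comment> \<open>If \<open>a\<close> is in \<open>J\<close> but outside \<open>T\<close>,
        then \<open>x\<close> is already zero. In the other case, whenever \<open>a\<close> is in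
        \<open>J\<close> it is in \<open>T\<close>, hence precedes every point outside
        \<open>T\<close>.\<close>
      proof (cases "a \<in> T \<or> a \<notin> J")
        case False
        then have "x = \<zero>\<^bsub>obj f a\<^esub>" using dies_outside[OF a _ xT] by blast
        then show ?thesis using submodule_zero[OF hom_submodule[OF G_dn a]] by simp
      next
        case True
        have "y \<in> \<Omega> G a"
        proof (cases "J \<in> ended_by T")
          case True
          then have "below J \<subseteq> G"
            using downset_latticeD[OF dn] by (auto simp: down_def G_def)
          then show ?thesis using hom_mono[OF J_dn(1) G_dn a] y by blast
        next
          case not_ended: False
          have "y \<in> \<Omega> (strictly_below J) a"
          proof (cases "a \<in> J")
            case False
            then show ?thesis using quotient_outside[OF J a] y by blast
          next
            case a_J: True
            \<comment> \<open>A point of \<open>J\<close> where \<open>x\<close> has already died,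
              at which injectivity for \<open>J\<close> is to be tested.\<close>
            obtain c where c: "c \<in> V" "c \<notin> T"
              using not_ended segment_ended_by_iff[OF less.hyps] by (auto simp: J_def)
            have c_pt: "c \<in> points" using downset_points less.hyps(1) c(1) .
            have "a \<preceq> c" using downset_above[OF T _ c(2) c_pt] \<open>a \<in> T \<or> a \<notin> J\<close> a_J by blast
            moreover have "s \<preceq> a" using a_J by (simp add: J_def segment_def)
            ultimately have "c \<in> J"
              using trans[of s a c] a c c_pt downset_points[OF less.hyps] by (simp add: J_def segment_def)
            interpret linear_map R "obj f a" "obj f c" "arr f a c"
              using arr_linear_map a c_pt \<open>a \<preceq> c\<close> .
            \<comment> \<open>At \<open>c\<close> the images of \<open>e\<close> and
              \<open>y\<close> cancel, so the image of \<open>y\<close> lies in the values of both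
              \<open>G\<close> and \<open>below J\<close>, and preservation of meets
              applies.\<close>
            have "arr f a c e \<oplus>\<^bsub>obj f c\<^esub> arr f a c y = \<zero>\<^bsub>obj f c\<^esub>"
              using xT c c_pt \<open>a \<preceq> c\<close> by (simp add: eyx dies_def flip: map_add[OF carr])
            then have "arr f a c y = \<ominus>\<^bsub>obj f c\<^esub> arr f a c e"
              using carr map_closed N.minus_equality N.a_comm by metis
            then have "arr f a c y \<in> \<Omega> G c"
              using hom_arr[OF G_dn a c_pt \<open>a \<preceq> c\<close> e] submodule_neg[OF hom_submodule[OF G_dn c_pt]]
              by simp
            moreover have "arr f a c y \<in> \<Omega> (below J) c"
              using hom_arr[OF J_dn(1) a c_pt \<open>a \<preceq> c\<close> y] .
            ultimately have "arr f a c y \<in> \<Omega> (G \<inter> below J) c"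
              using hom_Int[OF G_dn J_dn(1) c_pt] by blast
            moreover have "G \<inter> below J \<subseteq> strictly_below J"
              using G_iff[OF less.hyps] not_ended by (auto simp: strict_down_eq J_def lex_less_def)
            ultimately have "arr f a c y \<in> \<Omega> (strictly_below J) c"
              using hom_mono[OF downset_lattice_Int[OF G_dn J_dn(1)] J_dn(2) c_pt] by blast
            then show ?thesis
              using quotient_inj[OF J a_J \<open>c \<in> J\<close> \<open>a \<preceq> c\<close> y] by blast
          qed
          then show ?thesis using hom_mono[OF J_dn(2) G_dn a strictly_below_G] by blast
        qed
        then show ?thesis
          using eyx e submodule_add[OF hom_submodule[OF G_dn a]] by blast
      qed
      then have "x \<in> \<Omega> (ended_by T) a \<or> (\<exists>(r, W)\<in>P. x \<in> \<Omega> (up_to T r W) a)"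
        using reduce[of P x] P by (simp add: G_def)
      then show "x \<in> \<Omega> (ended_by T) a"
        using less.IH xT by (auto simp: P_def)
    qed
  qed
  show "dies T a \<subseteq> \<Omega> (ended_by T) a"
  proof
    fix x assume x: "x \<in> dies T a"
    \<comment> \<open>The descent starts from all bars, whose stretches exhaust the intervals; there
      the value is the whole module.\<close>
    define P where "P = {(s, V). V \<in> downsets \<and> s \<in> V}"
    have "J \<in> (\<Union>(s, V)\<in>P. up_to T s V)" if J: "J \<in> intervals I" for J
    proof -
      obtain s V where "V \<in> downsets" "s \<in> V" "J = segment s V"
        using J by (rule interval_cases)
      moreover from this have "(s, V) \<in> P" "J \<in> up_to T s V"
        using up_to_self by (simp_all add: P_def)
      ultimately show ?thesis by blast
    qed
    moreover have "up_to T s V \<subseteq> intervals I" if "(s, V) \<in> P" for s V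
      using interval_downset_intervals[OF up_to_downset] that by (auto simp: P_def)
    moreover have "ended_by T \<subseteq> intervals I"
      using interval_downset_intervals[OF dn] by blast
    ultimately have "ended_by T \<union> (\<Union>(s, V)\<in>P. up_to T s V) = intervals I"
      by blast
    then have "x \<in> \<Omega> (ended_by T \<union> (\<Union>(s, V)\<in>P. up_to T s V)) a"
      using hom_all[OF a] dies_carrier[OF x] by simp
    then have "x \<in> \<Omega> (ended_by T) a \<or> (\<exists>(s, V)\<in>P. x \<in> \<Omega> (up_to T s V) a)"
      by (intro reduce) (auto simp: P_def)
    then show "x \<in> \<Omega> (ended_by T) a"
      using up_to x by (auto simp: P_def)
  qed
qed

text \<open>For a bar \<open>(s, T)\<close> over \<open>a\<close> both maps give
  \<open>born s a \<inter> dies T a\<close> on the principal down-set. Intervals missing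
  \<open>a\<close> have no bar over \<open>a\<close> on one side and add nothing by
  \<open>quotient_outside\<close> on the other.\<close>

lemma hom_eq_interval_sum:
  assumes D: "D \<in> interval_downsets"
  shows "\<Omega> D = interval_sum D"
proof (rule subfunctor_eqI[OF hom_subfunctor[OF D] interval_sum_subfunctor])
  fix a assume a: "a \<in> points"
  have below: "\<Omega> (below (segment s T)) a = born s a \<inter> dies T a"
    if "T \<in> downsets" "s \<in> T" "s \<preceq> a" for s T
    using that hom_Int[OF started_by_downset ended_by_downset a] hom_started_by hom_ended_by a
      downset_points by (simp add: below_eq)
  show "\<Omega> D a = interval_sum D a"
  proof
    show "\<Omega> D a \<subseteq> interval_sum D a"
    proof (rule hom_induct[OF D a interval_sum_submodule[OF a]])
      fix J assume J: "J \<in> D" and IH: "\<Omega> (strictly_below J) a \<subseteq> interval_sum D a"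
      have J': "J \<in> intervals I" using interval_downset_intervals[OF D J] .
      obtain s T where T: "T \<in> downsets" "s \<in> T" "J = segment s T"
        using J' by (rule interval_cases)
      show "\<Omega> (below J) a \<subseteq> interval_sum D a"
      proof (cases "a \<in> J")
        case False
        then show ?thesis using quotient_outside[OF J' a] IH by blast
      next
        case True
        then have "(s, T) \<in> bars D a" "s \<preceq> a"
          using T J downset_points by (auto simp: bars_iff segment_def)
        then show ?thesis
          using below[OF T(1,2)] T(3) generatorsI generators_in_interval_sum[OF a] by blast
      qed
    qed
    show "interval_sum D a \<subseteq> \<Omega> D a"
    proof (rule interval_sum_least[OF a hom_submodule[OF D a]], rule subsetI)
      fix x assume "x \<in> generators D a"
      then obtain s T where st: "(s, T) \<in> bars D a" "x \<in> born s a" "x \<in> dies T a"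
        by (rule generatorsE)
      then have J: "T \<in> downsets" "s \<in> T" "s \<preceq> a" "segment s T \<in> D"
        using bars_points[OF st(1)] by (auto simp: bars_iff)
      have "below (segment s T) \<subseteq> D"
        using downset_latticeD[OF D J(4)] by (auto simp: down_def)
      then have "\<Omega> (below (segment s T)) a \<subseteq> \<Omega> D a"
        using hom_mono[OF down_interval_downset[OF segment_interval[OF J(1,2)]] D a] by blast
      then show "x \<in> \<Omega> D a" using below[OF J(1-3)] st by blast
    qed
  qed
qed

end

theorem theorem1:
  fixes I :: "'i gorder"
    and R :: "'r ring"
    and s :: side
    and f :: "('i, 'r, 'm) diagram"
  assumes "well_ordered_set I"
    and "ring R"
    and "is_functor s R I f"
  shows "\<exists>!\<Omega>. \<Omega> \<in> complete_lattice_hom (downset_lattice (interval_poset I)) (Sub R I f) \<and>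
           (\<forall>J \<in> carrier (interval_poset I).
              quotient_diagram f (\<Omega> (down (interval_poset I) J)) (\<Omega> (strict_down (interval_poset I) J))
                \<in> interval_diagrams s R I J)"
proof -
  interpret module_diagram I s R f
    using assms by unfold_locales
  have carrier: "carrier (interval_poset I) = intervals I"
    by (simp add: interval_poset_def)
  show ?thesis
  proof (rule ex1I[of _ "restrict interval_sum interval_downsets"])
    show "restrict interval_sum interval_downsets
        \<in> complete_lattice_hom (downset_lattice (interval_poset I)) (Sub R I f) \<and>
      (\<forall>J \<in> carrier (interval_poset I).
        quotient_diagram f (restrict interval_sum interval_downsets (down (interval_poset I) J))
            (restrict interval_sum interval_downsets (strict_down (interval_poset I) J))
          \<in> interval_diagrams s R I J)"
      using interval_sum_hom interval_sum_quotient
      by (simp add: carrier down_interval_downset strict_down_interval_downset)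
  next
    fix \<Omega>
    assume \<Omega>: "\<Omega> \<in> complete_lattice_hom (downset_lattice (interval_poset I)) (Sub R I f) \<and>
      (\<forall>J \<in> carrier (interval_poset I).
        quotient_diagram f (\<Omega> (down (interval_poset I) J)) (\<Omega> (strict_down (interval_poset I) J))
          \<in> interval_diagrams s R I J)"
    then interpret interval_filtration I s R f \<Omega>
      by unfold_locales (simp_all add: carrier)
    \<comment> \<open>Off the down-sets of intervals both maps are \<open>undefined\<close>, so
      agreement on down-sets suffices for equality.\<close>
    have "\<Omega> \<in> extensional interval_downsets"
      using \<Omega> by (auto simp: complete_lattice_hom_def PiE_def)
    then show "\<Omega> = restrict interval_sum interval_downsets"
      using hom_eq_interval_sum by (intro extensionalityI[where A = interval_downsets]) auto
  qed
qed

end
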